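(* Let $\mathcal{P}$ be a hereditary property of ordered graphs such that for some $t \in \mathbb{N}$, neither $K_t$ nor $K_{t,t}$ is in $\mathcal{P}$. Suppose that for every constant $c > 0$ there exists $N = N(c) \in \mathbb{N}$ such that $|\mathcal{P}_N| > c^N$. Then $\mathcal{P}$ contains the ordered graph $H(\pi)$ for every $k \in \mathbb{N}$ and every permutation $\pi$ of $[k]$, and hence $$|\mathcal{P}_n| \ge |\mathcal{P}^{(1,2)}_n| \ge \sum_{k=0}^{\lfloor n/2 \rfloor} \binom{n}{2k} k! = n^{n/2 + o(n)}$$ for every $n \in \mathbb{N}$. This lower bound is best possible, and among the hereditary properties of ordered graphs which, for some $t \in \mathbb{N}$, contain neither $K_t$ nor $K_{t,t}$, there is exactly one property $\mathcal{Q}$ with this speed, i.e. with $|\mathcal{Q}_n| = \sum_{k=0}^{\lfloor n/2 \rfloor} \binom{n}{2k} k!$ for every $n \in \mathbb{N}$.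
   Context: An ordered graph is a finite (simple, undirected) graph together with a linear order on its vertices. A property of ordered graphs is a collection of ordered graphs closed under order-preserving isomorphisms. It is hereditary if it is closed under taking induced subgraphs (with the induced order). $\mathcal{P}_n$ is the collection of distinct (non-isomorphic under order-preserving isomorphism) ordered graphs on $n$ vertices in $\mathcal{P}$, and the speed of $\mathcal{P}$ is the function $n \mapsto |\mathcal{P}_n|$. $\mathcal{P}^{(1,2)}$ denotes the set of ordered graphs in $\mathcal{P}$ with maximum degree at most $1$. $K_t$ denotes the complete ordered graph on $t$ vertices, and $K_{t,t}$ the ordered graph on $[2t]$ with edge set $\{\{i,j\} : i \le t < j\}$. For a permutation $\pi$ of $[k] = \{1,\ldots,k\}$, $H(\pi)$ is the ordered graph with vertex set $[2k]$ (usual order) and edge set $\{\{i,\pi(i)+k\} : i \in [k]\}$. *)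

theory Defs
  imports "HOL-Library.Landau_Symbols" "HOL-Combinatorics.Permutations"
begin

record 'v ograph =
  verts :: "'v set"
  edges :: "'v set set"
  vord :: "'v rel"  \<comment> \<open>non-strict linear order\<close>

definition ordered_graph :: "'v ograph \<Rightarrow> bool" where
  "ordered_graph G \<longleftrightarrow>
     finite (verts G) \<and>
     edges G \<subseteq> {e. e \<subseteq> verts G \<and> card e = 2} \<and>
     linear_order_on (verts G) (vord G)"

definition ograph_iso :: "'v ograph \<Rightarrow> 'w ograph \<Rightarrow> bool" where
  "ograph_iso G H \<longleftrightarrow>
     (\<exists>f. bij_betw f (verts G) (verts H) \<and>
          (\<forall>u\<in>verts G. \<forall>v\<in>verts G. (u, v) \<in> vord G \<longleftrightarrow> (f u, f v) \<in> vord H) \<and>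
          (\<forall>u\<in>verts G. \<forall>v\<in>verts G. {u, v} \<in> edges G \<longleftrightarrow> {f u, f v} \<in> edges H))"

definition induced_subgraph :: "'v ograph \<Rightarrow> 'v set \<Rightarrow> 'v ograph" where
  "induced_subgraph G S =
     \<lparr>verts = S, edges = {e \<in> edges G. e \<subseteq> S}, vord = vord G \<inter> S \<times> S\<rparr>"

definition degree :: "'v ograph \<Rightarrow> 'v \<Rightarrow> nat" where
  "degree G v = card {e \<in> edges G. v \<in> e}"

text \<open>
  Properties are taken over ordered graphs whose vertices are natural numbers. The vertex order is
  part of the structure and need not be the usual one. Every finite ordered graph is isomorphic to
  such a graph, so an isomorphism-closed collection is determined by these members.
\<close>

definition ograph_property :: "nat ograph set \<Rightarrow> bool" where
  "ograph_property P \<longleftrightarrow>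
     (\<forall>G\<in>P. ordered_graph G) \<and>
     (\<forall>G\<in>P. \<forall>H. ordered_graph H \<and> ograph_iso G H \<longrightarrow> H \<in> P)"

definition hereditary :: "nat ograph set \<Rightarrow> bool" where
  "hereditary P \<longleftrightarrow>
     ograph_property P \<and> (\<forall>G\<in>P. \<forall>S\<subseteq>verts G. induced_subgraph G S \<in> P)"

text \<open>The members of \<open>P\<close> on \<open>n\<close> vertices, up to order-preserving isomorphism.\<close>

definition level :: "nat ograph set \<Rightarrow> nat \<Rightarrow> nat ograph set set" where
  "level P n =
     {G \<in> P. card (verts G) = n} // {(G, H). G \<in> P \<and> H \<in> P \<and> ograph_iso G H}"

definition speed :: "nat ograph set \<Rightarrow> nat \<Rightarrow> nat" where
  "speed P n = card (level P n)"

definition max_degree_le_1 :: "nat ograph set \<Rightarrow> nat ograph set" where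
  "max_degree_le_1 P = {G \<in> P. \<forall>v\<in>verts G. degree G v \<le> 1}"

definition std_ograph :: "nat \<Rightarrow> nat set set \<Rightarrow> nat ograph" where
  "std_ograph n E =
     \<lparr>verts = {1..n}, edges = E, vord = {(i, j). i \<in> {1..n} \<and> j \<in> {1..n} \<and> i \<le> j}\<rparr>"

definition complete_ograph :: "nat \<Rightarrow> nat ograph" where
  "complete_ograph t = std_ograph t {e. e \<subseteq> {1..t} \<and> card e = 2}"

definition complete_bipartite_ograph :: "nat \<Rightarrow> nat ograph" where
  "complete_bipartite_ograph t =
     std_ograph (2 * t) {{i, j} |i j. i \<in> {1..t} \<and> j \<in> {t<..2 * t}}"

definition perm_ograph :: "nat \<Rightarrow> (nat \<Rightarrow> nat) \<Rightarrow> nat ograph" where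
  "perm_ograph k p = std_ograph (2 * k) {{i, p i + k} |i. i \<in> {1..k}}"

definition omits_complete :: "nat ograph set \<Rightarrow> bool" where
  "omits_complete P \<longleftrightarrow>
     (\<exists>t. complete_ograph t \<notin> P \<and> complete_bipartite_ograph t \<notin> P)"

definition superexponential :: "nat ograph set \<Rightarrow> bool" where
  "superexponential P \<longleftrightarrow> (\<forall>c::real. c > 0 \<longrightarrow> (\<exists>N. real (speed P N) > c ^ N))"

definition min_speed :: "nat \<Rightarrow> nat" where
  "min_speed n = (\<Sum>k=0..n div 2. (n choose (2 * k)) * fact k)"

end

theory Submission
  imports Defs "HOL-Library.Ramsey" "HOL-Real_Asymp.Real_Asymp"
begin

text \<open>
  Suppose \<open>H(\<pi>)\<close> is not in \<open>P\<close>. Blow every edge of \<open>H(\<pi>)\<close> up to a large group of parallel edges. If a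
  graph of \<open>P\<close> contained the blow-up as a not necessarily induced subgraph, one could choose one edge
  from each group so that no further adjacencies occur: by Ramsey's theorem, omitting \<open>K\<^sub>t\<close> and
  \<open>K\<^sub>t\<^sub>,\<^sub>t\<close> rules out large bicliques \<open>X < Y\<close>, so the adjacencies between two groups can be removed by
  shrinking both. The result would be an induced \<open>H(\<pi>)\<close>. So all graphs of \<open>P\<close> avoid one fixed
  \<open>H(\<sigma>)\<close> as a subgraph, and by the Marcus-Tardos theorem, combined with Klazar's contraction
  argument, there are only exponentially many of these.

  Conversely, the induced subgraphs of the graphs \<open>H(\<pi>)\<close> are the matchings all of whose left endpoints
  precede all right endpoints, with isolated vertices anywhere. There are exactly \<open>min_speed n\<close> of
  these on \<open>n\<close> vertices, so a property with this speed consists of nothing else.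
\<close>

section \<open>The Marcus-Tardos theorem\<close>

text \<open>The linear edge bound concerns containment that ignores additional adjacencies, whereas
  heredity only controls induced subgraphs: a complete graph has quadratically many edges and no
  induced \<open>H(\<pi>)\<close> with two or more edges. The blow-up bridges this gap because it is
  again a permutation graph, so the bound applies to it as it stands. A second mismatch is that a
  pattern in the adjacency matrix compares rows only with rows and columns only with columns, while
  \<open>H(\<pi>)\<close> also needs every left endpoint before every right endpoint; one additional
  entry in the pattern enforces this. No constant has to be sharp, since any bound of the form
  \<open>C ^ n\<close> contradicts superexponential speed. For uniqueness, the minimal speed is
  itself superexponential, so the first claim applies to the property in question and puts all split
  matchings into it; equality of finite cardinalities on each level does the rest.\<close>

definition matrix_contains :: "(nat \<times> nat) set \<Rightarrow> nat \<Rightarrow> (nat \<Rightarrow> nat) \<Rightarrow> bool" where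
  "matrix_contains R k p \<longleftrightarrow>
     (\<exists>f g. strict_mono_on {..<k} f \<and> strict_mono_on {..<k} g \<and> (\<forall>i<k. (f i, g (p i)) \<in> R))"

definition contract :: "nat \<Rightarrow> (nat \<times> nat) set \<Rightarrow> (nat \<times> nat) set" where
  "contract q R = (\<lambda>(a, b). (a div q, b div q)) ` R"

definition block :: "nat \<Rightarrow> (nat \<times> nat) set \<Rightarrow> nat \<times> nat \<Rightarrow> (nat \<times> nat) set" where
  "block q R B = {(a, b) \<in> R. (a div q, b div q) = B}"

lemma nat_less_if_div_less: "(a::nat) div q < b div q \<Longrightarrow> a < b"
  by (meson div_le_mono leD leI)

lemma div_eq_iff_atLeastLessThan:
  fixes a q J :: nat
  assumes "q > 0"
  shows "a div q = J \<longleftrightarrow> a \<in> {J * q..<J * q + q}"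
proof
  assume "a div q = J"
  then show "a \<in> {J * q..<J * q + q}"
    using div_mult_mod_eq[of a q] mod_less_divisor[OF assms, of a] by auto
next
  assume "a \<in> {J * q..<J * q + q}"
  then show "a div q = J"
    by (intro div_nat_eqI) (auto simp: mult.commute)
qed

lemma permutes_lessThan_iff:
  fixes k :: nat
  assumes "p permutes {..<k}"
  shows "p i < k \<longleftrightarrow> i < k"
  using permutes_in_image[OF assms, of i] by simp

lemma matrix_contains_converse:
  assumes "matrix_contains (R\<inverse>) k (inv p)" and p: "p permutes {..<k}"
  shows "matrix_contains R k p"
proof -
  obtain f g where fg: "strict_mono_on {..<k} f" "strict_mono_on {..<k} g"
    and R: "\<And>i. i < k \<Longrightarrow> (g (inv p i), f i) \<in> R"
    using assms(1) by (auto simp: matrix_contains_def)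
  have "(g i, f (p i)) \<in> R" if "i < k" for i
    using R[of "p i"] that p by (simp add: permutes_lessThan_iff permutes_inverses)
  with fg show ?thesis by (auto simp: matrix_contains_def)
qed

text \<open>A permutation pattern has exactly one entry in each row and in each column, so one point
  of \<open>R\<close> can be picked from each selected block without any two picks competing for a
  coordinate. The order of the picked coordinates is inherited from their quotients by
  \<open>q\<close>. The last two conclusions allow further facts about block indices, such as rows
  preceding columns, to be lifted as well.\<close>

lemma contract_lift:
  fixes k :: nat
  assumes p: "p permutes {..<k}"
    and fg: "strict_mono_on {..<k} f" "strict_mono_on {..<k} g"
    and R: "\<And>i. i < k \<Longrightarrow> (f i, g (p i)) \<in> contract q R"
  obtains f' g' where "strict_mono_on {..<k} f'" "strict_mono_on {..<k} g'"
    "\<And>i. i < k \<Longrightarrow> (f' i, g' (p i)) \<in> R"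
    "\<And>i. i < k \<Longrightarrow> f' i div q = f i" "\<And>i. i < k \<Longrightarrow> g' i div q = g i"
proof -
  have "\<exists>x. x \<in> R \<and> fst x div q = f i \<and> snd x div q = g (p i)" if "i < k" for i
    using R[OF that] by (fastforce simp: contract_def)
  then obtain x where x: "\<And>i. i < k \<Longrightarrow> x i \<in> R \<and> fst (x i) div q = f i \<and> snd (x i) div q = g (p i)"
    by metis
  define f' where "f' i = fst (x i)" for i
  \<comment> \<open>Column \<open>i\<close> of the pattern carries the entry of row
    \<open>inv p i\<close>, so its position is read off from that pick.\<close>
  define g' where "g' i = snd (x (inv p i))" for i
  have ip: "inv p i < k \<longleftrightarrow> i < k" for i
    using permutes_lessThan_iff[OF permutes_inv[OF p]] .
  have f': "f' i div q = f i" if "i < k" for i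
    using x[OF that] by (simp add: f'_def)
  have g': "g' i div q = g i" if "i < k" for i
    using x[of "inv p i"] that p by (simp add: g'_def ip permutes_inverses)
  show ?thesis
  proof
    show "strict_mono_on {..<k} f'"
      by (rule strict_mono_onI) (metis f' fg(1) lessThan_iff nat_less_if_div_less strict_mono_onD)
    show "strict_mono_on {..<k} g'"
      by (rule strict_mono_onI) (metis g' fg(2) lessThan_iff nat_less_if_div_less strict_mono_onD)
    show "(f' i, g' (p i)) \<in> R" if "i < k" for i
      using x[OF that] p by (simp add: f'_def g'_def permutes_inverses)
  qed (use f' g' in auto)
qed

lemma matrix_contains_contract:
  assumes "p permutes {..<k}" "matrix_contains (contract q R) k p"
  shows "matrix_contains R k p"
proof -
  obtain f g where "strict_mono_on {..<k} f" "strict_mono_on {..<k} g"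
    "\<And>i. i < k \<Longrightarrow> (f i, g (p i)) \<in> contract q R"
    using assms(2) by (auto simp: matrix_contains_def)
  from contract_lift[OF assms(1) this] show ?thesis
    unfolding matrix_contains_def by metis
qed

text \<open>Too many blocks in one column of blocks that meet at least \<open>k\<close> columns would yield \<open>k\<close> blocks
  meeting the same \<open>k\<close> columns, and then every pattern on \<open>k\<close> points.\<close>

lemma card_wide_blocks_le:
  assumes p: "p permutes {..<k}" and R: "\<not> matrix_contains R k p"
    and "q > 0" and W: "W = {I. k \<le> card (snd ` block q R (I, J))}" and "finite W"
  shows "card W \<le> k * 2 ^ q"
proof (rule ccontr)
  assume "\<not> ?thesis"
  then have big: "card W > k * 2 ^ q" by simp
  have "\<exists>T. T \<subseteq> snd ` block q R (I, J) \<and> card T = k" if "I \<in> W" for I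
    using that W by (meson mem_Collect_eq obtain_subset_with_card_n)
  then obtain T where T: "\<And>I. I \<in> W \<Longrightarrow> T I \<subseteq> snd ` block q R (I, J) \<and> card (T I) = k"
    by metis
  \<comment> \<open>All wide blocks in block column \<open>J\<close> meet subsets of the same
    \<open>q\<close> columns. There are only \<open>2 ^ q\<close> such subsets, so more than
    \<open>k\<close> blocks share one choice \<open>T0\<close>.\<close>
  let ?B = "Pow {J * q..<J * q + q}"
  have "snd ` block q R (I, J) \<subseteq> {J * q..<J * q + q}" for I
    using div_eq_iff_atLeastLessThan[OF \<open>q > 0\<close>] unfolding block_def by fastforce
  with T have "T \<in> W \<rightarrow> ?B" by blast
  from pigeonhole_card[OF this \<open>finite W\<close>] obtain T0 where
    T0: "card (T -` {T0} \<inter> W) * 2 ^ q \<ge> card W" "T0 \<subseteq> {J * q..<J * q + q}"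
    by (auto simp: card_Pow)
  let ?F = "T -` {T0} \<inter> W"
  have "k * 2 ^ q < card ?F * 2 ^ q" using T0 big by linarith
  then have F: "card ?F > k" by simp
  then have "?F \<noteq> {}" by auto
  then have cT0: "card T0 = k" using T by blast
  have "finite T0" using T0(2) finite_subset by blast
  then obtain g where g: "bij_betw g {..<k} T0" "strict_mono_on {..<k} g"
    using ex_bij_betw_strict_mono_card[of T0] cT0 by metis
  have "finite ?F" using \<open>finite W\<close> by simp
  then obtain h where h: "bij_betw h {..<card ?F} ?F" "strict_mono_on {..<card ?F} h"
    using ex_bij_betw_strict_mono_card[of ?F] by metis
  \<comment> \<open>The elements of \<open>T0\<close> serve as pattern columns, and row
    \<open>i\<close> of the pattern is taken from the \<open>i\<close>-th of the common blocks,
    which has a point in every column of \<open>T0\<close>.\<close>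
  have "\<exists>r. (r, g (p i)) \<in> R \<and> r div q = h i" if "i < k" for i
  proof -
    have "h i \<in> ?F" using h(1) F that by (meson bij_betwE lessThan_iff less_trans)
    moreover have "g (p i) \<in> T0"
      using g(1) p that by (meson bij_betwE lessThan_iff permutes_lessThan_iff)
    ultimately have "g (p i) \<in> snd ` block q R (h i, J)" using T by blast
    then show ?thesis by (auto simp: block_def)
  qed
  then obtain f where f: "\<And>i. i < k \<Longrightarrow> (f i, g (p i)) \<in> R \<and> f i div q = h i"
    by metis
  have "strict_mono_on {..<k} f"
  proof (rule strict_mono_onI)
    fix i j assume ij: "i \<in> {..<k}" "j \<in> {..<k}" "i < j"
    then have "h i < h j" using h(2) F by (intro strict_mono_onD[OF h(2)]) auto
    then show "f i < f j" using f ij nat_less_if_div_less by (metis lessThan_iff)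
  qed
  then have "matrix_contains R k p" using f g(2) by (auto simp: matrix_contains_def)
  with R show False by simp
qed

lemma card_wide_blocks_total:
  assumes p: "p permutes {..<k}" and R: "\<not> matrix_contains R k p"
    and "q > 0" and sub: "contract q R \<subseteq> {..<m} \<times> {..<m}"
  shows "card {B \<in> contract q R. k \<le> card (snd ` block q R B)} \<le> m * (k * 2 ^ q)"
proof (cases "k = 0")
  \<comment> \<open>For \<open>k = 0\<close> even empty blocks would count as wide, but the empty
    pattern is contained in every matrix.\<close>
  case True
  then have "matrix_contains R k p" by (auto simp: matrix_contains_def intro!: strict_mono_onI)
  with R show ?thesis by simp
next
  case False
  define W where "W J = {I. k \<le> card (snd ` block q R (I, J))}" for J
  have ne: "B \<in> contract q R" if "k \<le> card (snd ` block q R B)" for B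
  proof -
    have "block q R B \<noteq> {}" using that False by auto
    then show ?thesis by (auto simp: block_def contract_def)
  qed
  have WI: "W J \<subseteq> {..<m}" for J using ne sub unfolding W_def by blast
  then have fin: "finite (W J)" for J using finite_subset by blast
  have "{B \<in> contract q R. k \<le> card (snd ` block q R B)} \<subseteq> (\<Union>J\<in>{..<m}. W J \<times> {J})"
    using sub by (auto simp: W_def)
  then have "card {B \<in> contract q R. k \<le> card (snd ` block q R B)} \<le> card (\<Union>J\<in>{..<m}. W J \<times> {J})"
    using fin by (intro card_mono) auto
  also have "\<dots> \<le> (\<Sum>J<m. card (W J \<times> {J}))" by (rule card_UN_le) simp
  also have "\<dots> \<le> (\<Sum>J<m. k * 2 ^ q)"
    using card_wide_blocks_le[OF p R \<open>q > 0\<close> W_def fin] by (intro sum_mono) (simp add: card_cartesian_product)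
  finally show ?thesis by simp
qed

lemma block_converse: "block q (R\<inverse>) (b, a) = (block q R (a, b))\<inverse>"
  by (auto simp: block_def)

lemma contract_converse: "contract q (R\<inverse>) = (contract q R)\<inverse>"
  by (auto simp: contract_def)

text \<open>Transposition turns tall blocks into wide ones and the pattern \<open>p\<close> into
  \<open>inv p\<close>.\<close>

lemma card_tall_blocks_total:
  assumes p: "p permutes {..<k}" and R: "\<not> matrix_contains R k p"
    and "q > 0" and sub: "contract q R \<subseteq> {..<m} \<times> {..<m}"
  shows "card {B \<in> contract q R. k \<le> card (fst ` block q R B)} \<le> m * (k * 2 ^ q)"
proof -
  have R': "\<not> matrix_contains (R\<inverse>) k (inv p)"
    using R matrix_contains_converse[OF _ p] by blast
  have fs: "fst ` X = snd ` (X\<inverse>)" for X :: "(nat \<times> nat) set" by force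
  have "{B \<in> contract q (R\<inverse>). k \<le> card (snd ` block q (R\<inverse>) B)} =
        prod.swap ` {B \<in> contract q R. k \<le> card (fst ` block q R B)}"
    by (force simp: contract_converse block_converse fs)
  then have "card {B \<in> contract q R. k \<le> card (fst ` block q R B)} =
      card {B \<in> contract q (R\<inverse>). k \<le> card (snd ` block q (R\<inverse>) B)}"
    by (simp add: card_image)
  also have "\<dots> \<le> m * (k * 2 ^ q)"
    using sub by (intro card_wide_blocks_total[OF permutes_inv[OF p] R' \<open>q > 0\<close>])
      (auto simp: contract_converse)
  finally show ?thesis .
qed

text \<open>A block that is neither wide nor tall lies in a grid of at most \<open>k - 1\<close>
  rows and \<open>k - 1\<close> columns, so it holds at most \<open>(k - 1)\<^sup>2\<close> points.
  The exceptional blocks may be full, but their number is only linear in \<open>m\<close>.\<close>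

lemma card_le_contract:
  assumes p: "p permutes {..<k}" and R: "\<not> matrix_contains R k p" and fin: "finite R"
    and "q > 0" and sub: "contract q R \<subseteq> {..<m} \<times> {..<m}"
  shows "card R \<le> (k - 1)\<^sup>2 * card (contract q R) + 2 * q\<^sup>2 * (k * 2 ^ q) * m"
proof -
  let ?C = "contract q R"
  have finC: "finite ?C" using fin by (simp add: contract_def)
  have finB: "finite (block q R B)" for B
    using fin by (rule finite_subset[rotated]) (auto simp: block_def)
  define wide where "wide = {B \<in> ?C. k \<le> card (snd ` block q R B)}"
  define tall where "tall = {B \<in> ?C. k \<le> card (fst ` block q R B)}"
  have bnd: "card (block q R B) \<le> (k - 1)\<^sup>2 + (if B \<in> wide then q\<^sup>2 else 0) + (if B \<in> tall then q\<^sup>2 else 0)"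
    if B: "B \<in> ?C" for B
  proof -
    obtain I J where IJ: "B = (I, J)" by (cases B)
    have "block q R B \<subseteq> fst ` block q R B \<times> snd ` block q R B" by force
    then have le: "card (block q R B) \<le> card (fst ` block q R B) * card (snd ` block q R B)"
      using finB by (metis card_cartesian_product card_mono finite_SigmaI finite_imageI)
    have "fst ` block q R B \<subseteq> {I * q..<I * q + q}" "snd ` block q R B \<subseteq> {J * q..<J * q + q}"
      using div_eq_iff_atLeastLessThan[OF \<open>q > 0\<close>] unfolding block_def IJ by fastforce+
    then have "card (fst ` block q R B) \<le> q" "card (snd ` block q R B) \<le> q"
      using card_mono[of "{I * q..<I * q + q}"] card_mono[of "{J * q..<J * q + q}"] by fastforce+
    then have q: "card (block q R B) \<le> q\<^sup>2"
      using order_trans[OF le mult_le_mono] by (simp add: power2_eq_square)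
    show ?thesis
    proof (cases "B \<in> wide \<or> B \<in> tall")
      case True
      with q show ?thesis by auto
    next
      case False
      then have "card (fst ` block q R B) \<le> k - 1" "card (snd ` block q R B) \<le> k - 1"
        using B by (auto simp: wide_def tall_def)
      then have "card (block q R B) \<le> (k - 1)\<^sup>2"
        using order_trans[OF le mult_le_mono] by (simp add: power2_eq_square)
      then show ?thesis by simp
    qed
  qed
  have "x \<in> (\<Union>B\<in>?C. block q R B)" if "x \<in> R" for x
  proof (rule UN_I)
    show "(case x of (a, b) \<Rightarrow> (a div q, b div q)) \<in> ?C"
      unfolding contract_def using that by (rule imageI)
    show "x \<in> block q R (case x of (a, b) \<Rightarrow> (a div q, b div q))"
      using that by (cases x) (simp add: block_def)
  qed
  then have "card R \<le> card (\<Union>B\<in>?C. block q R B)"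
    using finC finB by (intro card_mono) auto
  also have "\<dots> \<le> (\<Sum>B\<in>?C. card (block q R B))" by (rule card_UN_le[OF finC])
  also have "\<dots> \<le> (\<Sum>B\<in>?C. (k - 1)\<^sup>2 + (if B \<in> wide then q\<^sup>2 else 0) + (if B \<in> tall then q\<^sup>2 else 0))"
    by (intro sum_mono bnd)
  also have "\<dots> = (k - 1)\<^sup>2 * card ?C + q\<^sup>2 * card wide + q\<^sup>2 * card tall"
  proof -
    have "?C \<inter> wide = wide" "?C \<inter> tall = tall" by (auto simp: wide_def tall_def)
    then show ?thesis by (simp add: sum.distrib finC flip: sum.inter_restrict)
  qed
  also have "\<dots> \<le> (k - 1)\<^sup>2 * card ?C + q\<^sup>2 * (m * (k * 2 ^ q)) + q\<^sup>2 * (m * (k * 2 ^ q))"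
    using card_wide_blocks_total[OF p R \<open>q > 0\<close> sub] card_tall_blocks_total[OF p R \<open>q > 0\<close> sub]
    unfolding wide_def tall_def by (intro add_mono mult_left_mono) auto
  finally show ?thesis by (simp add: algebra_simps)
qed

text \<open>Blocks of side \<open>k\<^sup>2\<close> give a recursion with factor
  \<open>(k - 1)\<^sup>2\<close> on a matrix smaller by the factor \<open>k\<^sup>2\<close>, plus a
  linear term. Since \<open>(k - 1)\<^sup>2\<close> is the smaller of the two factors, the solution
  is linear.\<close>

theorem marcus_tardos:
  assumes p: "p permutes {..<k}"
  shows "\<exists>C. \<forall>n R. R \<subseteq> {..<n} \<times> {..<n} \<and> \<not> matrix_contains R k p \<longrightarrow> card R \<le> C * n"
proof (cases "k \<le> 1")
  case True
  have "card R \<le> 0 * n" if R: "R \<subseteq> {..<n} \<times> {..<n}" "\<not> matrix_contains R k p" for n R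
  proof -
    have "R = {}"
    proof (rule ccontr)
      assume "R \<noteq> {}"
      then obtain a b where "(a, b) \<in> R" by auto
      then have "matrix_contains R k p"
        unfolding matrix_contains_def using True
        by (intro exI[of _ "\<lambda>_. a"] exI[of _ "\<lambda>_. b"]) (auto intro!: strict_mono_onI)
      with R show False by simp
    qed
    then show ?thesis by simp
  qed
  then show ?thesis by blast
next
  case False
  define q where "q = k\<^sup>2"
  define D where "D = 2 * q\<^sup>2 * (k * 2 ^ q)"
  \<comment> \<open>\<open>D\<close> pays for the wide and tall blocks of one contraction,
    \<open>k ^ 4\<close> for the matrices of side less than \<open>k ^ 4\<close>, where the
    recursion stops.\<close>
  define C where "C = D + k ^ 4"
  have q: "q > 1" using False by (simp add: q_def one_less_power del: One_nat_def)
  have "card R \<le> C * n" if "R \<subseteq> {..<n} \<times> {..<n}" "\<not> matrix_contains R k p" for n R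
    using that
  proof (induction n arbitrary: R rule: less_induct)
    case (less n)
    have fin: "finite R" using less.prems(1) finite_subset by blast
    show ?case
    proof (cases "n < k ^ 4")
      case True
      have "card R \<le> n * n"
        using card_mono[OF _ less.prems(1)] by (simp add: card_cartesian_product)
      also have "\<dots> \<le> C * n" using True by (intro mult_right_mono) (auto simp: C_def)
      finally show ?thesis .
    next
      case big: False
      define m where "m = n div q + 1"
      have sub: "contract q R \<subseteq> {..<m} \<times> {..<m}"
        using less.prems(1) by (fastforce simp: contract_def m_def intro: le_imp_less_Suc div_le_mono)
      have k4: "k ^ 4 = q * q" by (simp add: q_def flip: power_add)
      \<comment> \<open>Here \<open>k\<^sup>2 = (k - 1)\<^sup>2 + 1 + 2 * (k - 1)\<close>: the
        surplus \<open>2 * (k - 1)\<close> absorbs the rounding in \<open>m\<close>, which after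
        multiplication by \<open>q\<close> costs at most \<open>q * q \<le> n\<close>. The summand 1
        on the left makes room for the linear term of the recursion.\<close>
      have ineq: "((k - 1)\<^sup>2 + 1) * m \<le> n"
      proof -
        obtain j where j: "k = j + 2" using False by (metis add.commute le_Suc_ex not_less_eq_eq numeral_2_eq_2 One_nat_def)
        have qm: "q * m \<le> n + q" by (simp add: m_def distrib_left)
        have nq: "q * q \<le> n" using big k4 by simp
        have e: "(k - 1)\<^sup>2 + 1 + 2 * (k - 1) = q" by (simp add: j q_def power2_eq_square)
        have "q * (((k - 1)\<^sup>2 + 1) * m) = ((k - 1)\<^sup>2 + 1) * (q * m)" by (simp add: algebra_simps)
        also have "\<dots> \<le> ((k - 1)\<^sup>2 + 1) * (n + q)" using qm by (rule mult_left_mono) simp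
        also have "\<dots> = ((k - 1)\<^sup>2 + 1) * n + ((k - 1)\<^sup>2 + 1) * q" by (simp add: algebra_simps)
        also have "((k - 1)\<^sup>2 + 1) * q \<le> q * q" using e by (intro mult_right_mono) auto
        also note nq
        also have "((k - 1)\<^sup>2 + 1) * n + n \<le> (((k - 1)\<^sup>2 + 1) + 2 * (k - 1)) * n"
          using j by (simp add: algebra_simps)
        also have "\<dots> = q * n" using e by simp
        finally show ?thesis using q by simp
      qed
      have "m < n"
      proof -
        have "2 * m \<le> ((k - 1)\<^sup>2 + 1) * m" using False by (intro mult_right_mono) (auto simp: Suc_le_eq)
        with ineq show ?thesis by (simp add: m_def)
      qed
      moreover have "\<not> matrix_contains (contract q R) k p"
        using less.prems(2) matrix_contains_contract[OF p] by blast
      ultimately have IH: "card (contract q R) \<le> C * m" using less.IH sub by blast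
      have "card R \<le> (k - 1)\<^sup>2 * card (contract q R) + D * m"
        using card_le_contract[OF p less.prems(2) fin _ sub] q by (simp add: D_def)
      also have "\<dots> \<le> (k - 1)\<^sup>2 * (C * m) + C * m"
        using IH by (intro add_mono mult_left_mono mult_right_mono) (auto simp: C_def)
      also have "\<dots> = C * (((k - 1)\<^sup>2 + 1) * m)" by (simp add: algebra_simps)
      also have "\<dots> \<le> C * n" using ineq by (rule mult_left_mono) simp
      finally show ?thesis .
    qed
  qed
  then show ?thesis by blast
qed

section \<open>Counting ordered graphs that avoid a pattern\<close>

text \<open>This is \<open>H(p)\<close> as a not necessarily induced subgraph, with 0-based
  positions; the pairs in \<open>R\<close> are adjacencies, and \<open>f\<close> and
  \<open>g\<close> place the left and the right endpoints.\<close>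

definition graph_contains :: "(nat \<times> nat) set \<Rightarrow> nat \<Rightarrow> (nat \<Rightarrow> nat) \<Rightarrow> bool" where
  "graph_contains R k p \<longleftrightarrow>
     (\<exists>f g. strict_mono_on {..<k} f \<and> strict_mono_on {..<k} g \<and>
        (\<forall>i<k. \<forall>j<k. f i < g j) \<and> (\<forall>i<k. (f i, g (p i)) \<in> R))"

lemma graph_contains_mono: "graph_contains R k p \<Longrightarrow> R \<subseteq> S \<Longrightarrow> graph_contains S k p"
  unfolding graph_contains_def by blast

text \<open>The extra point in the bottom left corner forces all rows of the pattern below all its columns.\<close>

definition corner_extension :: "nat \<Rightarrow> (nat \<Rightarrow> nat) \<Rightarrow> nat \<Rightarrow> nat" where
  "corner_extension k p i = (if i < k then Suc (p i) else if i = k then 0 else i)"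

lemma corner_extension_permutes:
  assumes "p permutes {..<k}"
  shows "corner_extension k p permutes {..<Suc k}"
proof (rule bij_imp_permutes)
  have "inj p" using assms by (rule permutes_inj)
  have inj: "inj_on (corner_extension k p) {..<Suc k}"
    by (rule inj_onI) (auto simp: corner_extension_def inj_eq[OF \<open>inj p\<close>] split: if_splits)
  moreover have "corner_extension k p ` {..<Suc k} \<subseteq> {..<Suc k}"
    using permutes_lessThan_iff[OF assms] by (auto simp: corner_extension_def)
  ultimately have "corner_extension k p ` {..<Suc k} = {..<Suc k}"
    by (intro endo_inj_surj) auto
  with inj show "bij_betw (corner_extension k p) {..<Suc k} {..<Suc k}"
    by (simp add: bij_betw_def)
qed (auto simp: corner_extension_def)

lemma graph_contains_if_matrix_contains:
  assumes "R \<subseteq> {(a, b). a < b}" "matrix_contains R (Suc k) (corner_extension k p)"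
  shows "graph_contains R k p"
proof -
  obtain f g where f: "strict_mono_on {..<Suc k} f" and g: "strict_mono_on {..<Suc k} g"
    and R: "\<And>i. i < Suc k \<Longrightarrow> (f i, g (corner_extension k p i)) \<in> R"
    using assms(2) by (auto simp: matrix_contains_def)
  \<comment> \<open>The corner entry sits in pattern row \<open>k\<close> and column 0; as
    \<open>R\<close> lies above the diagonal, it puts the last row position before the first column
    position.\<close>
  have fk: "f k < g 0" using R[of k] assms(1) by (auto simp: corner_extension_def)
  show ?thesis
    unfolding graph_contains_def
  proof (intro exI conjI allI impI)
    show "strict_mono_on {..<k} f" "strict_mono_on {..<k} (\<lambda>i. g (Suc i))"
      by (auto intro!: strict_mono_onI strict_mono_onD[OF f] strict_mono_onD[OF g])
    show "(f i, g (Suc (p i))) \<in> R" if "i < k" for i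
      using R[of i] that by (simp add: corner_extension_def)
    show "f i < g (Suc j)" if "i < k" "j < k" for i j
    proof -
      have "f i < f k" using that by (intro strict_mono_onD[OF f]) auto
      also note fk
      also have "g 0 < g (Suc j)" using that by (intro strict_mono_onD[OF g]) auto
      finally show ?thesis .
    qed
  qed
qed

lemma graph_contains_contract:
  assumes p: "p permutes {..<k}" and "graph_contains (contract q R) k p"
  shows "graph_contains R k p"
proof -
  obtain f g where "strict_mono_on {..<k} f" "strict_mono_on {..<k} g"
    "\<And>i. i < k \<Longrightarrow> (f i, g (p i)) \<in> contract q R" and less: "\<And>i j. i < k \<Longrightarrow> j < k \<Longrightarrow> f i < g j"
    using assms(2) by (auto simp: graph_contains_def)
  from contract_lift[OF p this(1-3)] obtain f' g'
    where fg': "strict_mono_on {..<k} f'" "strict_mono_on {..<k} g'"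
    "\<And>i. i < k \<Longrightarrow> (f' i, g' (p i)) \<in> R"
    "\<And>i. i < k \<Longrightarrow> f' i div q = f i" "\<And>i. i < k \<Longrightarrow> g' i div q = g i"
    by metis
  have "f' i < g' j" if "i < k" "j < k" for i j
    using less[OF that] fg'(4)[OF that(1)] fg'(5)[OF that(2)] nat_less_if_div_less by metis
  with fg' show ?thesis unfolding graph_contains_def by metis
qed

definition avoiding_graphs :: "nat \<Rightarrow> (nat \<Rightarrow> nat) \<Rightarrow> nat \<Rightarrow> (nat \<times> nat) set set" where
  "avoiding_graphs k p n = {R. R \<subseteq> {(a, b). a < b \<and> b < n} \<and> \<not> graph_contains R k p}"

lemma finite_avoiding_graphs: "finite (avoiding_graphs k p n)"
proof -
  have "avoiding_graphs k p n \<subseteq> Pow ({..<n} \<times> {..<n})"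
    by (auto simp: avoiding_graphs_def)
  then show ?thesis by (rule finite_subset) simp
qed

text \<open>Merging consecutive pairs of vertices halves the number of vertices and forgets only linearly many
  bits, since the contracted graph has linearly many edges.\<close>

theorem card_avoiding_graphs_le:
  assumes p: "p permutes {..<k}"
  shows "\<exists>D. \<forall>n. card (avoiding_graphs k p n) \<le> 2 ^ (D * n)"
proof -
  obtain C where C: "\<And>n R. R \<subseteq> {..<n} \<times> {..<n} \<Longrightarrow>
      \<not> matrix_contains R (Suc k) (corner_extension k p) \<Longrightarrow> card R \<le> C * n"
    using marcus_tardos[OF corner_extension_permutes[OF p]] by blast
  have edges: "card R \<le> C * n" if "R \<in> avoiding_graphs k p n" for R n
  proof (rule C)
    show "R \<subseteq> {..<n} \<times> {..<n}" using that by (auto simp: avoiding_graphs_def)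
    show "\<not> matrix_contains R (Suc k) (corner_extension k p)"
      using that graph_contains_if_matrix_contains[of R k p] by (auto simp: avoiding_graphs_def)
  qed
  \<comment> \<open>Each edge between merged vertices can come from at most 4 original pairs, and
    each of the \<open>m\<close> merged vertices can hide one more edge.\<close>
  define c where "c = 4 * C + 1"
  have "card (avoiding_graphs k p n) \<le> 2 ^ (2 * c * n)" for n
  proof (induction n rule: less_induct)
    case (less n)
    show ?case
    proof (cases "n < 2")
      case True
      then have "avoiding_graphs k p n \<subseteq> {{}}" by (auto simp: avoiding_graphs_def)
      then have "card (avoiding_graphs k p n) \<le> card {{} :: (nat \<times> nat) set}" by (intro card_mono) auto
      then show ?thesis by (rule order_trans) simp
    next
      case False
      define m where "m = (n + 1) div 2"
      have m: "m < n" "2 * (c * m) + c * m \<le> 2 * (c * n)"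
      proof -
        show "m < n" using False by (simp add: m_def)
        \<comment> \<open>The worst case of rounding up is \<open>n = 3\<close>,
          \<open>m = 2\<close>. The factor 2 in the exponent \<open>2 * c * n\<close> is chosen so
          that the recursion closes even there.\<close>
        have "3 * m \<le> 2 * n" using False unfolding m_def by linarith
        then have "c * (3 * m) \<le> c * (2 * n)" by (rule mult_left_mono) simp
        then show "2 * (c * m) + c * m \<le> 2 * (c * n)" by (simp add: algebra_simps)
      qed
      \<comment> \<open>\<open>U Q\<close> collects all pairs that a graph with contraction
        \<open>Q\<close> may have, so \<open>Q\<close> has at most \<open>2 ^ card (U Q)\<close>
        preimages.\<close>
      define U where "U Q = (\<Union>e\<in>Q. {2 * fst e, 2 * fst e + 1} \<times> {2 * snd e, 2 * snd e + 1})
          \<union> (\<lambda>i. (2 * i, 2 * i + 1)) ` {..<m}" for Q :: "(nat \<times> nat) set"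
      \<comment> \<open>The contraction of an edge inside a merged pair is a loop and is dropped
        here; such edges are accounted for by the second part of \<open>U\<close>.\<close>
      define \<phi> where "\<phi> R = contract 2 R \<inter> {(a, b). a < b}" for R
      have \<phi>: "\<phi> R \<in> avoiding_graphs k p m \<and> R \<subseteq> U (\<phi> R)" if R: "R \<in> avoiding_graphs k p n" for R
      proof
        have "\<not> graph_contains (\<phi> R) k p"
          using R graph_contains_contract[OF p] graph_contains_mono[of "\<phi> R" k p "contract 2 R"]
          by (auto simp: avoiding_graphs_def \<phi>_def)
        moreover have "\<phi> R \<subseteq> {(a, b). a < b \<and> b < m}"
          using R by (fastforce simp: avoiding_graphs_def \<phi>_def contract_def m_def)
        ultimately show "\<phi> R \<in> avoiding_graphs k p m" by (simp add: avoiding_graphs_def)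
        show "R \<subseteq> U (\<phi> R)"
        proof
          fix e assume e: "e \<in> R"
          obtain a b where ab: "e = (a, b)" by (cases e)
          have lt: "a < b" "b < n" using e R by (auto simp: ab avoiding_graphs_def)
          show "e \<in> U (\<phi> R)"
          proof (cases "a div 2 = b div 2")
            case True
            then have "a = 2 * (a div 2)" "b = 2 * (a div 2) + 1" "a div 2 < m"
              using lt unfolding m_def by linarith+
            then have "e \<in> (\<lambda>i. (2 * i, 2 * i + 1)) ` {..<m}" unfolding ab by blast
            then show ?thesis by (simp add: U_def)
          next
            case False
            then have "a div 2 < b div 2" using lt by (simp add: div_le_mono nat_less_le)
            then have "(a div 2, b div 2) \<in> \<phi> R"
              using e by (force simp: \<phi>_def contract_def ab)
            then have "e \<in> (\<Union>e\<in>\<phi> R. {2 * fst e, 2 * fst e + 1} \<times> {2 * snd e, 2 * snd e + 1})"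
            proof (rule UN_I)
              have "a \<in> {2 * (a div 2), 2 * (a div 2) + 1}" "b \<in> {2 * (b div 2), 2 * (b div 2) + 1}"
                by auto
              then show "e \<in> {2 * fst (a div 2, b div 2), 2 * fst (a div 2, b div 2) + 1} \<times>
                  {2 * snd (a div 2, b div 2), 2 * snd (a div 2, b div 2) + 1}"
                unfolding ab fst_conv snd_conv by (rule SigmaI)
            qed
            then show ?thesis unfolding U_def by (rule UnI1)
          qed
        qed
      qed
      have U: "finite (U Q) \<and> card (U Q) \<le> c * m" if Q: "Q \<in> avoiding_graphs k p m" for Q
      proof
        have "Q \<subseteq> {..<m} \<times> {..<m}" using Q by (auto simp: avoiding_graphs_def)
        then have fin: "finite Q" by (rule finite_subset) simp
        then show "finite (U Q)" by (auto simp: U_def)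
        have "card (\<Union>e\<in>Q. {2 * fst e, 2 * fst e + 1} \<times> {2 * snd e, 2 * snd e + 1})
            \<le> (\<Sum>e\<in>Q. card ({2 * fst e, 2 * fst e + 1} \<times> {2 * snd e, 2 * snd e + 1}))"
          by (rule card_UN_le[OF fin])
        also have "\<dots> = 4 * card Q" by (simp add: card_cartesian_product)
        also have "\<dots> \<le> 4 * (C * m)" using edges[OF Q] by simp
        finally have "card (\<Union>e\<in>Q. {2 * fst e, 2 * fst e + 1} \<times> {2 * snd e, 2 * snd e + 1}) \<le> 4 * (C * m)" .
        moreover have "card ((\<lambda>i. (2 * i, 2 * i + 1 :: nat)) ` {..<m}) \<le> m"
          using card_image_le[of "{..<m}"] by fastforce
        ultimately show "card (U Q) \<le> c * m"
          unfolding U_def c_def by (intro order_trans[OF card_Un_le]) (simp add: algebra_simps)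
      qed
      have "avoiding_graphs k p n \<subseteq> (\<Union>Q\<in>avoiding_graphs k p m. Pow (U Q))"
        using \<phi> by blast
      then have "card (avoiding_graphs k p n) \<le> card (\<Union>Q\<in>avoiding_graphs k p m. Pow (U Q))"
        using U finite_avoiding_graphs by (intro card_mono finite_UN_I) auto
      also have "\<dots> \<le> (\<Sum>Q\<in>avoiding_graphs k p m. card (Pow (U Q)))"
        by (rule card_UN_le[OF finite_avoiding_graphs])
      also have "\<dots> \<le> (\<Sum>Q\<in>avoiding_graphs k p m. 2 ^ (c * m))"
        using U by (intro sum_mono) (simp add: card_Pow)
      also have "\<dots> \<le> 2 ^ (2 * c * m) * 2 ^ (c * m)"
        using less.IH[OF m(1)] by simp
      also have "\<dots> \<le> 2 ^ (2 * c * n)"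
        using m(2) by (simp add: mult.assoc flip: power_add)
      finally show ?thesis .
    qed
  qed
  then show ?thesis by blast
qed

section \<open>Induced patterns in graphs without large bicliques\<close>

text \<open>Many vertices of \<open>Y\<close> have the same neighbourhood \<open>Z\<close> inside a
  set \<open>X0\<close> of \<open>2 * m\<close> vertices of \<open>X\<close>. If \<open>Z\<close>
  had \<open>m\<close> elements, it would form with them a biclique of order \<open>s\<close>; so at
  least \<open>m\<close> elements of \<open>X0\<close> lie outside \<open>Z\<close>.\<close>

lemma bipartite_ramsey:
  assumes "s \<le> m"
    and "card X \<ge> 2 * m" "finite X" "card Y \<ge> m * 2 ^ (2 * m)" "finite Y"
    and no_biclique: "\<And>X' Y'. X' \<subseteq> X \<Longrightarrow> Y' \<subseteq> Y \<Longrightarrow> card X' = s \<Longrightarrow> card Y' = s \<Longrightarrow>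
       \<exists>x\<in>X'. \<exists>y\<in>Y'. \<not> r x y"
  shows "\<exists>X' Y'. X' \<subseteq> X \<and> Y' \<subseteq> Y \<and> card X' = m \<and> card Y' = m \<and> (\<forall>x\<in>X'. \<forall>y\<in>Y'. \<not> r x y)"
proof -
  obtain X0 where X0: "X0 \<subseteq> X" "card X0 = 2 * m" "finite X0"
    using assms(2,3) by (meson finite_subset obtain_subset_with_card_n)
  define F where "F y = {x \<in> X0. r x y}" for y
  have "F \<in> Y \<rightarrow> Pow X0" by (auto simp: F_def)
  from pigeonhole_card[OF this \<open>finite Y\<close>] X0(3) obtain Z where
    Z: "Z \<subseteq> X0" "card (F -` {Z} \<inter> Y) * card (Pow X0) \<ge> card Y"
    by auto
  then have "m * 2 ^ (2 * m) \<le> card (F -` {Z} \<inter> Y) * 2 ^ (2 * m)"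
    using le_trans[OF assms(4)] X0(2,3) by (simp only: card_Pow)
  then have "m \<le> card (F -` {Z} \<inter> Y)" by simp
  then obtain Y' where Y': "Y' \<subseteq> F -` {Z} \<inter> Y" "card Y' = m" by (meson obtain_subset_with_card_n)
  have "card Z < m"
  proof (rule ccontr)
    assume "\<not> card Z < m"
    then obtain A where A: "A \<subseteq> Z" "card A = s" using \<open>s \<le> m\<close>
      by (meson le_trans not_less obtain_subset_with_card_n)
    obtain B where B: "B \<subseteq> Y'" "card B = s" using \<open>s \<le> m\<close> Y'(2)
      by (metis obtain_subset_with_card_n)
    have "r x y" if "x \<in> A" "y \<in> B" for x y
    proof -
      have "F y = Z" using that B Y' by auto
      then show ?thesis using that A by (auto simp: F_def)
    qed
    moreover have "A \<subseteq> X" "B \<subseteq> Y" using A B X0 Y' Z by auto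
    ultimately show False using no_biclique[of A B] A(2) B(2) by blast
  qed
  then have "m \<le> card (X0 - Z)"
    using X0 Z by (simp add: card_Diff_subset finite_subset)
  then obtain X' where X': "X' \<subseteq> X0 - Z" "card X' = m" by (meson obtain_subset_with_card_n)
  have "\<not> r x y" if "x \<in> X'" "y \<in> Y'" for x y
  proof -
    have "F y = Z" "x \<in> X0" "x \<notin> Z" using that X'(1) Y'(1) by auto
    then show ?thesis by (auto simp: F_def)
  qed
  moreover have "X' \<subseteq> X" "Y' \<subseteq> Y" using X' Y' X0 by auto
  ultimately show ?thesis using X'(2) Y'(2) by blast
qed

text \<open>The constraints are treated one at a time, because a non-adjacency once achieved
  survives all later shrinking. The size \<open>M\<close> is fixed before the groups and the
  relations, so that each further constraint merely enlarges it. The relation may depend on the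
  constraint, since two groups of edges impose several conditions, one for each choice of
  endpoints.\<close>

lemma multipartite_ramsey:
  fixes I :: "'i set" and a b :: "'c \<Rightarrow> 'i"
  assumes "finite C" and ab: "\<And>c. c \<in> C \<Longrightarrow> a c \<in> I \<and> b c \<in> I \<and> a c \<noteq> b c" and "s \<le> m"
  shows "\<exists>M\<ge>m. \<forall>(G :: 'i \<Rightarrow> 'x set) (r :: 'c \<Rightarrow> 'x \<Rightarrow> 'x \<Rightarrow> bool). (\<forall>i\<in>I. finite (G i) \<and> card (G i) \<ge> M) \<and>
      (\<forall>c\<in>C. \<forall>X Y. X \<subseteq> G (a c) \<and> Y \<subseteq> G (b c) \<and> card X = s \<and> card Y = s \<longrightarrow>
         (\<exists>x\<in>X. \<exists>y\<in>Y. \<not> r c x y)) \<longrightarrow>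
      (\<exists>G'. (\<forall>i\<in>I. G' i \<subseteq> G i \<and> card (G' i) \<ge> m) \<and>
         (\<forall>c\<in>C. \<forall>x\<in>G' (a c). \<forall>y\<in>G' (b c). \<not> r c x y))"
    (is "\<exists>M\<ge>m. ?P C M")
  using assms(1,2)
proof (induction C rule: finite_induct)
  case empty
  then show ?case by auto
next
  case (insert c C)
  have "\<exists>M\<ge>m. ?P C M" by (rule insert.IH) (use insert.prems in auto)
  then obtain M where "M \<ge> m" and M: "?P C M" by (elim exE conjE)
  have c: "a c \<in> I" "b c \<in> I" "a c \<noteq> b c" using insert.prems by auto
  \<comment> \<open>Large enough for both sides of the two-group statement, whose two size
    requirements differ.\<close>
  define N where "N = 2 * M + M * 2 ^ (2 * M)"
  show ?case
  proof (rule exI[of _ N], intro conjI allI impI)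
    show "m \<le> N" using \<open>M \<ge> m\<close> by (simp add: N_def)
    fix G and r :: "'c \<Rightarrow> 'x \<Rightarrow> 'x \<Rightarrow> bool"
    assume *: "(\<forall>i\<in>I. finite (G i) \<and> N \<le> card (G i)) \<and>
      (\<forall>c\<in>insert c C. \<forall>X Y. X \<subseteq> G (a c) \<and> Y \<subseteq> G (b c) \<and> card X = s \<and> card Y = s \<longrightarrow>
         (\<exists>x\<in>X. \<exists>y\<in>Y. \<not> r c x y))"
    have "s \<le> M" using \<open>s \<le> m\<close> \<open>M \<ge> m\<close> by simp
    moreover have "card (G (a c)) \<ge> 2 * M" "finite (G (a c))"
      "card (G (b c)) \<ge> M * 2 ^ (2 * M)" "finite (G (b c))"
      using *[THEN conjunct1, rule_format, OF c(1)] *[THEN conjunct1, rule_format, OF c(2)]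
      by (auto simp: N_def)
    moreover have "\<exists>x\<in>X'. \<exists>y\<in>Y'. \<not> r c x y"
      if "X' \<subseteq> G (a c)" "Y' \<subseteq> G (b c)" "card X' = s" "card Y' = s" for X' Y'
      using * that by blast
    ultimately have "\<exists>X Y. X \<subseteq> G (a c) \<and> Y \<subseteq> G (b c) \<and> card X = M \<and> card Y = M \<and>
        (\<forall>x\<in>X. \<forall>y\<in>Y. \<not> r c x y)"
      by (rule bipartite_ramsey)
    then obtain X Y where XY: "X \<subseteq> G (a c)" "Y \<subseteq> G (b c)" "card X = M" "card Y = M"
      "\<And>x y. x \<in> X \<Longrightarrow> y \<in> Y \<Longrightarrow> \<not> r c x y"
      by blast
    define H where "H = G(a c := X, b c := Y)"
    have HG: "H i \<subseteq> G i" for i using XY(1,2) by (auto simp: H_def)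
    have HM: "\<forall>i\<in>I. finite (H i) \<and> M \<le> card (H i)"
    proof
      fix i assume i: "i \<in> I"
      have Gi: "finite (G i)" "N \<le> card (G i)" using *[THEN conjunct1, rule_format, OF i] by auto
      have "finite (H i)" by (rule finite_subset[OF HG Gi(1)])
      moreover have "M \<le> N" by (simp add: N_def)
      then have "M \<le> card (G i)" using Gi(2) by simp
      ultimately show "finite (H i) \<and> M \<le> card (H i)" using XY(3,4) by (auto simp: H_def)
    qed
    have "\<forall>c\<in>C. \<forall>X Y. X \<subseteq> H (a c) \<and> Y \<subseteq> H (b c) \<and> card X = s \<and> card Y = s \<longrightarrow>
         (\<exists>x\<in>X. \<exists>y\<in>Y. \<not> r c x y)"
    proof (intro ballI allI impI)
      fix d X Y
      assume "d \<in> C" and d: "X \<subseteq> H (a d) \<and> Y \<subseteq> H (b d) \<and> card X = s \<and> card Y = s"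
      then have "X \<subseteq> G (a d) \<and> Y \<subseteq> G (b d) \<and> card X = s \<and> card Y = s"
        using HG by (meson order_trans)
      then show "\<exists>x\<in>X. \<exists>y\<in>Y. \<not> r d x y" using * \<open>d \<in> C\<close> by blast
    qed
    from M[THEN spec, THEN spec, THEN mp, OF conjI, OF HM this] obtain G' where G': "\<And>i. i \<in> I \<Longrightarrow> G' i \<subseteq> H i \<and> card (G' i) \<ge> m"
      "\<And>c x y. c \<in> C \<Longrightarrow> x \<in> G' (a c) \<Longrightarrow> y \<in> G' (b c) \<Longrightarrow> \<not> r c x y"
      by blast
    have "G' (a c) \<subseteq> X" "G' (b c) \<subseteq> Y" using G'(1) c by (auto simp: H_def dest!: G'(1))
    then have "\<not> r c x y" if "x \<in> G' (a c)" "y \<in> G' (b c)" for x y using XY(5) that by blast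
    then show "\<exists>G'. (\<forall>i\<in>I. G' i \<subseteq> G i \<and> card (G' i) \<ge> m) \<and>
         (\<forall>c\<in>insert c C. \<forall>x\<in>G' (a c). \<forall>y\<in>G' (b c). \<not> r c x y)"
      using G' HG by (intro exI[of _ G']) blast
  qed
qed

text \<open>Writing \<open>x = i * N + j\<close>, entry \<open>i\<close> of the pattern becomes an
  increasing run of \<open>N\<close> entries indexed by \<open>j\<close>. Outside the range the
  function is the identity, as \<open>permutes\<close> demands.\<close>

definition blow_up :: "nat \<Rightarrow> nat \<Rightarrow> (nat \<Rightarrow> nat) \<Rightarrow> nat \<Rightarrow> nat" where
  "blow_up k N p x = (if x < k * N then p (x div N) * N + x mod N else x)"

lemma index_less: "i < k \<Longrightarrow> j < N \<Longrightarrow> i * N + j < k * (N :: nat)"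
  by (metis add.commute less_mult_imp_div_less div_mult_self3 div_less add_0_right
      div_less_iff_less_mult gr_zeroI not_less_zero)

lemma index_strict_mono: "i < i' \<Longrightarrow> j < N \<Longrightarrow> i * N + j < i' * N + (j' :: nat)"
  using index_less[of i i' j N] by simp

lemma blow_up_index: "i < k \<Longrightarrow> j < N \<Longrightarrow> blow_up k N p (i * N + j) = p i * N + j"
  by (simp add: blow_up_def index_less)

lemma blow_up_permutes:
  assumes p: "p permutes {..<k}"
  shows "blow_up k N p permutes {..<k * N}"
proof (rule bij_imp_permutes)
  have sub: "blow_up k N p ` {..<k * N} \<subseteq> {..<k * N}"
  proof
    fix y assume "y \<in> blow_up k N p ` {..<k * N}"
    then obtain x where x: "x < k * N" "y = p (x div N) * N + x mod N" by (auto simp: blow_up_def)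
    then have "x div N < k" "x mod N < N"
      by (auto simp: less_mult_imp_div_less intro!: mod_less_divisor gr0I)
    with x show "y \<in> {..<k * N}" using permutes_lessThan_iff[OF p] by (auto intro!: index_less)
  qed
  have inj: "inj_on (blow_up k N p) {..<k * N}"
  proof (rule inj_onI)
    fix x y assume x: "x \<in> {..<k * N}" and y: "y \<in> {..<k * N}" and e: "blow_up k N p x = blow_up k N p y"
    then have N: "N > 0" by (auto intro!: gr0I)
    have e: "p (x div N) * N + x mod N = p (y div N) * N + y mod N" using e x y by (simp add: blow_up_def)
    have "x mod N = y mod N" using arg_cong[OF e, of "\<lambda>z. z mod N"] by simp
    moreover have "p (x div N) = p (y div N)" using arg_cong[OF e, of "\<lambda>z. z div N"] N by simp
    then have "x div N = y div N" using permutes_inj[OF p] by (simp add: inj_eq)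
    ultimately show "x = y" by (metis div_mult_mod_eq)
  qed
  with endo_inj_surj[OF _ sub inj] show "bij_betw (blow_up k N p) {..<k * N} {..<k * N}"
    by (simp add: bij_betw_def)
qed (simp add: blow_up_def)

text \<open>Group \<open>i\<close> consists of \<open>N\<close> edges of the copy of the blow-up,
  and one edge is selected from each group. For distinct groups, endpoints of fixed kinds occupy
  disjoint intervals, so one set precedes the other and the absence of large bicliques applies in
  one of the two directions. \<open>N\<close> is found before \<open>adj\<close>, so a single
  blow-up serves all graphs of a property.\<close>

lemma induced_pattern_if_blow_up:
  fixes p :: "nat \<Rightarrow> nat" and k s :: nat
  assumes p: "p permutes {..<k}"
  obtains N where "\<And>adj. symp adj \<Longrightarrow>
    (\<And>X Y. card X = s \<Longrightarrow> card Y = s \<Longrightarrow> \<exists>x\<in>X. \<exists>y\<in>Y. \<not> (x < y \<and> adj x y)) \<Longrightarrow>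
    graph_contains {(x, y). adj x y} (k * N) (blow_up k N p) \<Longrightarrow>
    \<exists>a b. strict_mono_on {..<k} a \<and> strict_mono_on {..<k} b \<and> (\<forall>i<k. \<forall>j<k. a i < b j) \<and>
      (\<forall>i<k. \<forall>j<k. i \<noteq> j \<longrightarrow> \<not> adj (a i) (a j) \<and> \<not> adj (b i) (b j)) \<and>
      (\<forall>i<k. \<forall>j<k. adj (a i) (b j) \<longleftrightarrow> j = p i)"
proof -
  \<comment> \<open>A constraint names two distinct groups and, by two booleans, whether left or
    right endpoints are compared in each.\<close>
  define C where "C = {(i, i') \<in> {..<k} \<times> {..<k}. i \<noteq> i'} \<times> (UNIV :: (bool \<times> bool) set)"
  define src where "src c = fst (fst c)" for c :: "(nat \<times> nat) \<times> (bool \<times> bool)"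
  define tgt where "tgt c = snd (fst c)" for c :: "(nat \<times> nat) \<times> (bool \<times> bool)"
  let ?P = "\<lambda>M. \<forall>(G :: nat \<Rightarrow> nat set) (r :: (nat \<times> nat) \<times> (bool \<times> bool) \<Rightarrow> nat \<Rightarrow> nat \<Rightarrow> bool).
      (\<forall>i\<in>{..<k}. finite (G i) \<and> card (G i) \<ge> M) \<and>
      (\<forall>c\<in>C. \<forall>X Y. X \<subseteq> G (src c) \<and> Y \<subseteq> G (tgt c) \<and> card X = s \<and> card Y = s \<longrightarrow>
         (\<exists>x\<in>X. \<exists>y\<in>Y. \<not> r c x y)) \<longrightarrow>
      (\<exists>G'. (\<forall>i\<in>{..<k}. G' i \<subseteq> G i \<and> card (G' i) \<ge> Suc s) \<and>
         (\<forall>c\<in>C. \<forall>x\<in>G' (src c). \<forall>y\<in>G' (tgt c). \<not> r c x y))"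
  have "finite C" unfolding C_def
    by (intro finite_cartesian_product finite_subset[of _ "{..<k} \<times> {..<k}"]) auto
  moreover have "src c \<in> {..<k} \<and> tgt c \<in> {..<k} \<and> src c \<noteq> tgt c" if "c \<in> C" for c
    using that by (auto simp: C_def src_def tgt_def)
  \<comment> \<open>Asking for \<open>Suc s\<close> keeps the shrunken groups nonempty whatever
    \<open>s\<close> is, so that an edge can be selected from each.\<close>
  moreover have "s \<le> Suc s" by simp
  ultimately have "\<exists>M\<ge>Suc s. ?P M"
    by (rule multipartite_ramsey)
  then obtain N where N: "?P N" by (elim exE conjE)
  show ?thesis
  proof (rule that)
    fix adj :: "nat \<Rightarrow> nat \<Rightarrow> bool"
    assume "symp adj"
      and no_biclique: "\<And>X Y. card X = s \<Longrightarrow> card Y = s \<Longrightarrow> \<exists>x\<in>X. \<exists>y\<in>Y. \<not> (x < y \<and> adj x y)"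
      and "graph_contains {(x, y). adj x y} (k * N) (blow_up k N p)"
    then obtain f g where f: "strict_mono_on {..<k * N} f" and g: "strict_mono_on {..<k * N} g"
      and fg: "\<And>i j. i < k * N \<Longrightarrow> j < k * N \<Longrightarrow> f i < g j"
      and fg_adj: "\<And>i. i < k * N \<Longrightarrow> adj (f i) (g (blow_up k N p i))"
      by (auto simp: graph_contains_def)
    have sym: "adj x y \<longleftrightarrow> adj y x" for x y using \<open>symp adj\<close> by (auto dest: sympD)
    have pk: "p i < k \<longleftrightarrow> i < k" for i using permutes_lessThan_iff[OF p] .
    have pp: "p i = p j \<longleftrightarrow> i = j" for i j using permutes_inj[OF p] by (simp add: inj_eq)
    \<comment> \<open>The \<open>j\<close>-th edge of group \<open>i\<close> joins
      \<open>pt True i j\<close> on the left to \<open>pt False i j\<close> on the right.\<close>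
    define pt where "pt t i j = (if t then f (i * N + j) else g (p i * N + j))" for t i j
    have f_less: "f x < f y" if "x < y" "y < k * N" for x y
      using that by (intro strict_mono_onD[OF f]) auto
    have g_less: "g x < g y" if "x < y" "y < k * N" for x y
      using that by (intro strict_mono_onD[OF g]) auto
    have pt_mono: "pt t i j < pt t i j'" if "i < k" "j < j'" "j' < N" for t i j j'
      using that by (auto simp: pt_def pk intro!: f_less g_less index_less)
    have pt_inj: "inj_on (pt t i) {..<N}" if "i < k" for t i
      by (rule strict_mono_on_imp_inj_on, rule strict_mono_onI) (use pt_mono that in simp)
    have separated: "(\<forall>x<N. \<forall>y<N. pt t i x < pt u i' y) \<or> (\<forall>x<N. \<forall>y<N. pt u i' y < pt t i x)"
      if "i < k" "i' < k" "i \<noteq> i'" for t u i i'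
    proof (cases t; cases u)
      assume "t" "u"
      with that show ?thesis
        by (cases "i < i'") (auto simp: pt_def intro!: f_less index_strict_mono index_less)
    next
      assume "\<not> t" "\<not> u"
      with that show ?thesis
        by (cases "p i < p i'")
          (auto simp: pt_def pk pp nat_neq_iff intro!: g_less index_strict_mono index_less)
    qed (use that in \<open>auto simp: pt_def pk intro!: fg index_less\<close>)
    define r where "r c x y = adj (pt (fst (snd c)) (src c) x) (pt (snd (snd c)) (tgt c) y)"
      for c :: "(nat \<times> nat) \<times> (bool \<times> bool)" and x y
    have "\<exists>G'. (\<forall>i\<in>{..<k}. G' i \<subseteq> {..<N} \<and> card (G' i) \<ge> Suc s) \<and>
         (\<forall>c\<in>C. \<forall>x\<in>G' (src c). \<forall>y\<in>G' (tgt c). \<not> r c x y)"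
    proof (rule N[THEN spec, THEN spec, THEN mp], rule conjI)
      show "\<forall>i\<in>{..<k}. finite {..<N} \<and> N \<le> card {..<N}" by simp
      show "\<forall>c\<in>C. \<forall>X Y. X \<subseteq> {..<N} \<and> Y \<subseteq> {..<N} \<and> card X = s \<and> card Y = s \<longrightarrow>
         (\<exists>x\<in>X. \<exists>y\<in>Y. \<not> r c x y)"
      proof (intro ballI allI impI, rule ccontr)
        fix c X Y
        assume c: "c \<in> C" and XY: "X \<subseteq> {..<N} \<and> Y \<subseteq> {..<N} \<and> card X = s \<and> card Y = s"
          and r: "\<not> (\<exists>x\<in>X. \<exists>y\<in>Y. \<not> r c x y)"
        obtain i i' t u where ceq: "c = ((i, i'), (t, u))" by (metis surj_pair)
        have i: "i < k" "i' < k" "i \<noteq> i'" using c by (auto simp: C_def ceq)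
        have crd: "card (pt t i ` X) = s" "card (pt u i' ` Y) = s"
          using XY pt_inj[OF i(1), of t] pt_inj[OF i(2), of u]
          by (auto simp: card_image inj_on_subset)
        have adj: "adj (pt t i x) (pt u i' y)" if "x \<in> X" "y \<in> Y" for x y
          using r that by (auto simp: r_def ceq src_def tgt_def)
        from separated[OF i, of t u] show False
        proof
          assume "\<forall>x<N. \<forall>y<N. pt t i x < pt u i' y"
          then show False using no_biclique[OF crd] adj XY by blast
        next
          assume "\<forall>x<N. \<forall>y<N. pt u i' y < pt t i x"
          then show False using no_biclique[OF crd(2,1)] adj XY sym by blast
        qed
      qed
    qed
    then obtain G' where "\<forall>i\<in>{..<k}. G' i \<subseteq> {..<N} \<and> card (G' i) \<ge> Suc s"
      and indep: "\<forall>c\<in>C. \<forall>x\<in>G' (src c). \<forall>y\<in>G' (tgt c). \<not> r c x y"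
      by (elim exE conjE)
    then have G': "G' i \<subseteq> {..<N} \<and> card (G' i) \<ge> Suc s" if "i < k" for i
      using that by simp
    have "\<exists>j. j \<in> G' i" if "i < k" for i using G'[OF that] by (cases "G' i = {}") auto
    then obtain e where e: "\<And>i. i < k \<Longrightarrow> e i \<in> G' i" by metis
    then have eN: "e i < N" if "i < k" for i using G' that by blast
    have nadj: "\<not> adj (pt t i (e i)) (pt u i' (e i'))" if "i < k" "i' < k" "i \<noteq> i'" for t u i i'
      using indep[rule_format, of "((i, i'), (t, u))" "e i" "e i'"] that e
      by (auto simp: C_def r_def src_def tgt_def)
    define a where "a i = pt True i (e i)" for i
    \<comment> \<open>Right endpoints are indexed by their position, so the group is recovered
      through \<open>inv p\<close>.\<close>
    define b where "b j = pt False (inv p j) (e (inv p j))" for j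
    have ipk: "inv p i < k \<longleftrightarrow> i < k" for i using permutes_lessThan_iff[OF permutes_inv[OF p]] .
    have pip: "p (inv p i) = i" "inv p (p i) = i" for i using permutes_inverses[OF p] by auto
    have "strict_mono_on {..<k} a"
      using eN by (intro strict_mono_onI) (auto simp: a_def pt_def intro!: f_less index_strict_mono index_less)
    moreover have "strict_mono_on {..<k} b"
      using eN by (intro strict_mono_onI)
        (auto simp: b_def pt_def pip ipk intro!: g_less index_strict_mono index_less)
    moreover have "a i < b j" if "i < k" "j < k" for i j
      using that eN by (auto simp: a_def b_def pt_def pip ipk intro!: fg index_less)
    moreover have "\<not> adj (a i) (a j) \<and> \<not> adj (b i) (b j)" if "i < k" "j < k" "i \<noteq> j" for i j
      using that nadj pip ipk unfolding a_def b_def by metis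
    moreover have "adj (a i) (b j) \<longleftrightarrow> j = p i" if "i < k" "j < k" for i j
    proof
      assume "adj (a i) (b j)"
      then have "i = inv p j" using nadj[of i "inv p j"] that ipk unfolding a_def b_def by blast
      then show "j = p i" by (simp add: pip)
    next
      assume "j = p i"
      then show "adj (a i) (b j)"
        using fg_adj[of "i * N + e i"] that eN[of i]
        by (simp add: a_def b_def pip pt_def blow_up_index index_less)
    qed
    ultimately show "\<exists>a b. strict_mono_on {..<k} a \<and> strict_mono_on {..<k} b \<and> (\<forall>i<k. \<forall>j<k. a i < b j) \<and>
      (\<forall>i<k. \<forall>j<k. i \<noteq> j \<longrightarrow> \<not> adj (a i) (a j) \<and> \<not> adj (b i) (b j)) \<and>
      (\<forall>i<k. \<forall>j<k. adj (a i) (b j) \<longleftrightarrow> j = p i)"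
      by blast
  qed
qed

section \<open>Standard representatives of ordered graphs\<close>

lemma ograph_iso_refl: "ograph_iso G G"
  unfolding ograph_iso_def by (intro exI[of _ id]) auto

lemma ograph_iso_sym:
  assumes "ograph_iso G H" shows "ograph_iso H G"
proof -
  obtain f where f: "bij_betw f (verts G) (verts H)"
    "\<And>u v. u \<in> verts G \<Longrightarrow> v \<in> verts G \<Longrightarrow> (u, v) \<in> vord G \<longleftrightarrow> (f u, f v) \<in> vord H"
    "\<And>u v. u \<in> verts G \<Longrightarrow> v \<in> verts G \<Longrightarrow> {u, v} \<in> edges G \<longleftrightarrow> {f u, f v} \<in> edges H"
    using assms unfolding ograph_iso_def by blast
  define g where "g = inv_into (verts G) f"
  have g: "g u \<in> verts G" "f (g u) = u" if "u \<in> verts H" for u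
    using that f(1) unfolding g_def bij_betw_def by (auto intro: inv_into_into f_inv_into_f)
  have "bij_betw g (verts H) (verts G)"
    unfolding g_def by (rule bij_betw_inv_into[OF f(1)])
  then show ?thesis
    unfolding ograph_iso_def using g f(2,3) by (intro exI[of _ g]) auto
qed

lemma ograph_iso_trans:
  assumes "ograph_iso G H" "ograph_iso H K" shows "ograph_iso G K"
proof -
  obtain f where f: "bij_betw f (verts G) (verts H)"
    "\<And>u v. u \<in> verts G \<Longrightarrow> v \<in> verts G \<Longrightarrow> (u, v) \<in> vord G \<longleftrightarrow> (f u, f v) \<in> vord H"
    "\<And>u v. u \<in> verts G \<Longrightarrow> v \<in> verts G \<Longrightarrow> {u, v} \<in> edges G \<longleftrightarrow> {f u, f v} \<in> edges H"
    using assms(1) unfolding ograph_iso_def by blast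
  obtain g where g: "bij_betw g (verts H) (verts K)"
    "\<And>u v. u \<in> verts H \<Longrightarrow> v \<in> verts H \<Longrightarrow> (u, v) \<in> vord H \<longleftrightarrow> (g u, g v) \<in> vord K"
    "\<And>u v. u \<in> verts H \<Longrightarrow> v \<in> verts H \<Longrightarrow> {u, v} \<in> edges H \<longleftrightarrow> {g u, g v} \<in> edges K"
    using assms(2) unfolding ograph_iso_def by blast
  have "f u \<in> verts H" if "u \<in> verts G" for u using f(1) that by (rule bij_betwE[rule_format])
  then show ?thesis
    unfolding ograph_iso_def using f(2,3) g(2,3)
    by (intro exI[of _ "g \<circ> f"]) (simp add: bij_betw_trans[OF f(1) g(1)])
qed

definition vertex_pairs :: "nat \<Rightarrow> nat set set" where
  "vertex_pairs n = {e. e \<subseteq> {1..n} \<and> card e = 2}"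

definition std_edges :: "nat ograph set \<Rightarrow> nat \<Rightarrow> nat set set set" where
  "std_edges P n = {E. E \<subseteq> vertex_pairs n \<and> std_ograph n E \<in> P}"

lemma finite_vertex_pairs: "finite (vertex_pairs n)"
  by (rule finite_subset[of _ "Pow {1..n}"]) (auto simp: vertex_pairs_def)

lemma finite_std_edges: "finite (std_edges P n)"
  by (rule finite_subset[of _ "Pow (vertex_pairs n)"]) (auto simp: std_edges_def finite_vertex_pairs)

lemma doubleton_in_vertex_pairs: "{u, v} \<in> vertex_pairs n \<longleftrightarrow> u \<in> {1..n} \<and> v \<in> {1..n} \<and> u \<noteq> v"
  by (auto simp: vertex_pairs_def card_insert_if)

lemma vertex_pairsE:
  assumes "e \<in> vertex_pairs n"
  obtains u v where "e = {u, v}" "u < v" "1 \<le> u" "v \<le> n"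
proof -
  obtain u v where "e = {u, v}" "u \<noteq> v" using assms by (auto simp: vertex_pairs_def card_2_iff)
  with assms that[of u v] that[of v u] show ?thesis
    by (cases "u < v") (auto simp: vertex_pairs_def)
qed

lemma vertex_pairs_ext:
  assumes "E \<subseteq> vertex_pairs n" "F \<subseteq> vertex_pairs n"
    and "\<And>u v. u < v \<Longrightarrow> {u, v} \<in> E \<longleftrightarrow> {u, v} \<in> F"
  shows "E = F"
proof (rule set_eqI)
  fix e
  show "e \<in> E \<longleftrightarrow> e \<in> F"
  proof (cases "e \<in> vertex_pairs n")
    case True
    then show ?thesis using assms(3) by (metis vertex_pairsE)
  qed (use assms(1,2) in auto)
qed

lemma std_ograph_simps [simp]:
  "verts (std_ograph n E) = {1..n}" "edges (std_ograph n E) = E"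
  "(i, j) \<in> vord (std_ograph n E) \<longleftrightarrow> i \<in> {1..n} \<and> j \<in> {1..n} \<and> i \<le> j"
  by (auto simp: std_ograph_def)

lemma ordered_graph_std_ograph: "ordered_graph (std_ograph n E) \<longleftrightarrow> E \<subseteq> vertex_pairs n"
  by (auto simp: ordered_graph_def vertex_pairs_def std_ograph_def linear_order_on_def
      partial_order_on_def preorder_on_def refl_on_def trans_def antisym_def total_on_def)

text \<open>Each vertex is sent to its rank, the number of vertices not above it in
  \<open>vord G\<close>.\<close>

lemma ex_std_ograph_iso:
  assumes "ordered_graph G" "card (verts G) = n"
  obtains E where "E \<subseteq> vertex_pairs n" "ograph_iso (std_ograph n E) G"
proof -
  have fin: "finite (verts G)" and edges: "edges G \<subseteq> {e. e \<subseteq> verts G \<and> card e = 2}"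
    and lin: "linear_order_on (verts G) (vord G)"
    using assms(1) by (auto simp: ordered_graph_def)
  have lin': "refl_on (verts G) (vord G)" "trans (vord G)" "antisym (vord G)" "total_on (verts G) (vord G)"
    using lin by (auto simp: linear_order_on_def partial_order_on_def preorder_on_def)
  note tr = transD[OF lin'(2)] and asym = antisymD[OF lin'(3)] and rfl = refl_onD[OF lin'(1)]
  have tot: "(x, y) \<in> vord G \<or> (y, x) \<in> vord G" if "x \<in> verts G" "y \<in> verts G" for x y
    using lin'(4) rfl that unfolding total_on_def by metis
  define f where "f v = card {u \<in> verts G. (u, v) \<in> vord G}" for v
  have le: "f u \<le> f v" if "(u, v) \<in> vord G" for u v
    unfolding f_def using fin that tr by (intro card_mono) auto
  have less: "f u < f v" if "(u, v) \<in> vord G" "u \<noteq> v" "u \<in> verts G" "v \<in> verts G" for u v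
    unfolding f_def
  proof (rule psubset_card_mono)
    show "{x \<in> verts G. (x, u) \<in> vord G} \<subset> {x \<in> verts G. (x, v) \<in> vord G}"
      using that tr asym rfl by blast
  qed (use fin in simp)
  have iff: "(u, v) \<in> vord G \<longleftrightarrow> f u \<le> f v" if "u \<in> verts G" "v \<in> verts G" for u v
    using le less[of v u] tot[of u v] rfl that by (metis leD)
  have inj: "inj_on f (verts G)"
    using less tot by (metis inj_onI less_irrefl)
  have "f ` verts G \<subseteq> {1..n}"
  proof (clarsimp, intro conjI)
    fix v assume v: "v \<in> verts G"
    have "{u \<in> verts G. (u, v) \<in> vord G} \<noteq> {}" using v rfl by blast
    then show "Suc 0 \<le> f v" unfolding f_def using fin by (simp add: Suc_le_eq card_gt_0_iff)
    show "f v \<le> n" unfolding f_def assms(2)[symmetric] using fin by (intro card_mono) auto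
  qed
  then have im: "f ` verts G = {1..n}"
    using inj assms(2) by (intro card_subset_eq) (auto simp: card_image)
  define E where "E = (`) f ` edges G"
  have E: "E \<subseteq> vertex_pairs n"
  proof
    fix e assume "e \<in> E"
    then obtain d where d: "d \<in> edges G" "e = f ` d" by (auto simp: E_def)
    then have dv: "d \<subseteq> verts G" "card d = 2" using edges by auto
    have "card e = 2" using d dv inj by (simp add: card_image inj_on_subset)
    moreover have "e \<subseteq> {1..n}" using d dv im by blast
    ultimately show "e \<in> vertex_pairs n" by (simp add: vertex_pairs_def)
  qed
  have edge: "{u, v} \<in> edges G \<longleftrightarrow> {f u, f v} \<in> E" if uv: "u \<in> verts G" "v \<in> verts G" for u v
  proof
    assume "{u, v} \<in> edges G"
    then have "f ` {u, v} \<in> E" unfolding E_def by (rule imageI)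
    then show "{f u, f v} \<in> E" by simp
  next
    assume "{f u, f v} \<in> E"
    then obtain d where d: "d \<in> edges G" "f ` {u, v} = f ` d" by (auto simp: E_def)
    then have "d \<subseteq> verts G" using edges by auto
    then have "{u, v} = d" using inj_on_image_eq_iff[OF inj, of "{u, v}" d] d(2) uv by simp
    with d show "{u, v} \<in> edges G" by simp
  qed
  have "ograph_iso G (std_ograph n E)"
    unfolding ograph_iso_def
  proof (intro exI[of _ f] conjI ballI)
    show "bij_betw f (verts G) (verts (std_ograph n E))" using inj im by (simp add: bij_betw_def)
    fix u v assume uv: "u \<in> verts G" "v \<in> verts G"
    then have "f u \<in> {1..n}" "f v \<in> {1..n}" using im by blast+
    then show "(u, v) \<in> vord G \<longleftrightarrow> (f u, f v) \<in> vord (std_ograph n E)" using iff[OF uv] by simp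
    show "{u, v} \<in> edges G \<longleftrightarrow> {f u, f v} \<in> edges (std_ograph n E)" using edge[OF uv] by simp
  qed
  then show ?thesis using that E ograph_iso_sym by blast
qed

text \<open>A finite linear order has no automorphism but the identity: an order-preserving
  bijection maps the initial segment up to \<open>i\<close> onto the one up to \<open>f i\<close>,
  and these must have equal size.\<close>

lemma std_ograph_iso_imp_eq:
  assumes E: "E \<subseteq> vertex_pairs n" and F: "F \<subseteq> vertex_pairs n"
    and iso: "ograph_iso (std_ograph n E) (std_ograph n F)"
  shows "E = F"
proof -
  obtain f where f: "bij_betw f {1..n} {1..n}"
    and ord: "\<And>u v. u \<in> {1..n} \<Longrightarrow> v \<in> {1..n} \<Longrightarrow> u \<le> v \<longleftrightarrow> f u \<le> f v"
    and edge: "\<And>u v. u \<in> {1..n} \<Longrightarrow> v \<in> {1..n} \<Longrightarrow> {u, v} \<in> E \<longleftrightarrow> {f u, f v} \<in> F"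
    using iso unfolding ograph_iso_def std_ograph_simps by (metis bij_betwE)
  have id: "f i = i" if i: "i \<in> {1..n}" for i
  proof -
    have fi: "f i \<in> {1..n}" using f i by (metis bij_betwE)
    have "f ` {1..i} = {1..f i}"
    proof
      show "f ` {1..i} \<subseteq> {1..f i}"
      proof
        fix y assume "y \<in> f ` {1..i}"
        then obtain j where j: "j \<in> {1..i}" "y = f j" by blast
        then have "j \<in> {1..n}" using i by auto
        then show "y \<in> {1..f i}" using j ord[of j i] i bij_betwE[OF f] by fastforce
      qed
      show "{1..f i} \<subseteq> f ` {1..i}"
      proof
        fix y assume y: "y \<in> {1..f i}"
        then have "y \<in> f ` {1..n}" using fi bij_betw_imp_surj_on[OF f] by auto
        then obtain j where j: "j \<in> {1..n}" "y = f j" by blast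
        then have "j \<le> i" using ord[of j i] i y by simp
        then show "y \<in> f ` {1..i}" using j by auto
      qed
    qed
    moreover have "inj_on f {1..i}"
      using bij_betw_imp_inj_on[OF f] by (rule inj_on_subset) (use i in auto)
    ultimately have "card {1..f i} = card {1..i}" by (metis card_image)
    then show ?thesis by simp
  qed
  show ?thesis
  proof (rule vertex_pairs_ext[OF E F])
    fix u v :: nat
    have "{u, v} \<in> E \<longleftrightarrow> {u, v} \<in> F" if "u \<in> {1..n}" "v \<in> {1..n}"
      using edge[OF that] id that by simp
    moreover have "{u, v} \<in> E \<or> {u, v} \<in> F \<Longrightarrow> u \<in> {1..n} \<and> v \<in> {1..n}"
      using E F by (auto simp: vertex_pairs_def)
    ultimately show "{u, v} \<in> E \<longleftrightarrow> {u, v} \<in> F" by blast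
  qed
qed

lemma ograph_property_ordered: "ograph_property P \<Longrightarrow> G \<in> P \<Longrightarrow> ordered_graph G"
  by (simp add: ograph_property_def)

lemma ograph_property_iso:
  "ograph_property P \<Longrightarrow> G \<in> P \<Longrightarrow> ordered_graph H \<Longrightarrow> ograph_iso G H \<Longrightarrow> H \<in> P"
  unfolding ograph_property_def by blast

lemma ex_std_edges_iso:
  assumes P: "ograph_property P" and G: "G \<in> P"
  obtains E where "E \<in> std_edges P (card (verts G))" "ograph_iso (std_ograph (card (verts G)) E) G"
proof -
  obtain E where E: "E \<subseteq> vertex_pairs (card (verts G))" "ograph_iso (std_ograph (card (verts G)) E) G"
    using ex_std_ograph_iso[OF ograph_property_ordered[OF P G] refl] by metis
  have "std_ograph (card (verts G)) E \<in> P"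
    using ograph_property_iso[OF P G _ ograph_iso_sym[OF E(2)]] E(1) by (simp add: ordered_graph_std_ograph)
  then show ?thesis using that E by (simp add: std_edges_def)
qed

text \<open>Each isomorphism class on \<open>n\<close> vertices contains exactly one graph
  \<open>std_ograph n E\<close>, so counting classes becomes counting edge sets. Speeds are compared
  in this form below, where inclusion and finiteness are at hand.\<close>

lemma speed_eq_card_std_edges:
  assumes P: "ograph_property P"
  shows "speed P n = card (std_edges P n)"
proof -
  define r where "r = {(G, H). G \<in> P \<and> H \<in> P \<and> ograph_iso G H}"
  have equiv: "equiv P r"
    by (intro equivI refl_onI symI transI)
      (auto simp: r_def intro: ograph_iso_refl ograph_iso_sym ograph_iso_trans)
  have "bij_betw (\<lambda>E. r `` {std_ograph n E}) (std_edges P n) (level P n)"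
    unfolding bij_betw_def
  proof
    show "inj_on (\<lambda>E. r `` {std_ograph n E}) (std_edges P n)"
    proof (rule inj_onI)
      fix E F assume E: "E \<in> std_edges P n" and F: "F \<in> std_edges P n"
        and "r `` {std_ograph n E} = r `` {std_ograph n F}"
      then have "(std_ograph n E, std_ograph n F) \<in> r"
        using eq_equiv_class_iff[OF equiv] by (auto simp: std_edges_def)
      then show "E = F" using E F std_ograph_iso_imp_eq by (auto simp: r_def std_edges_def)
    qed
    show "(\<lambda>E. r `` {std_ograph n E}) ` std_edges P n = level P n"
    proof
      show "(\<lambda>E. r `` {std_ograph n E}) ` std_edges P n \<subseteq> level P n"
        unfolding level_def r_def[symmetric] by (auto simp: std_edges_def intro!: quotientI)
      show "level P n \<subseteq> (\<lambda>E. r `` {std_ograph n E}) ` std_edges P n"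
      proof
        fix c assume "c \<in> level P n"
        then obtain G where G: "G \<in> P" "card (verts G) = n" "c = r `` {G}"
          unfolding level_def r_def[symmetric] by (auto elim: quotientE)
        obtain E where E: "E \<in> std_edges P n" "ograph_iso (std_ograph n E) G"
          using ex_std_edges_iso[OF P G(1)] G(2) by metis
        then have "(std_ograph n E, G) \<in> r" using G(1) by (auto simp: r_def std_edges_def)
        then have "r `` {std_ograph n E} = c" using equiv_class_eq[OF equiv] G(3) by simp
        with E show "c \<in> (\<lambda>E. r `` {std_ograph n E}) ` std_edges P n" by blast
      qed
    qed
  qed
  then show ?thesis unfolding speed_def by (metis bij_betw_same_card)
qed

section \<open>Heredity through order-preserving embeddings, and the absence of large
  bicliques\<close>

text \<open>The form in which heredity is used: the image of \<open>\<phi>\<close> induces a graph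
  isomorphic to \<open>std_ograph m F\<close>. Comparing edges for \<open>i < j\<close> suffices
  because neither side has loops.\<close>

lemma std_ograph_embedding:
  assumes P: "hereditary P" and E: "E \<in> std_edges P n" and F: "F \<subseteq> vertex_pairs m"
    and \<phi>: "strict_mono_on {1..m} \<phi>" "\<phi> ` {1..m} \<subseteq> {1..n}"
    and edge: "\<And>i j. 1 \<le> i \<Longrightarrow> i < j \<Longrightarrow> j \<le> m \<Longrightarrow> {i, j} \<in> F \<longleftrightarrow> {\<phi> i, \<phi> j} \<in> E"
  shows "std_ograph m F \<in> P"
proof -
  have property: "ograph_property P" using P by (simp add: hereditary_def)
  have Ep: "E \<subseteq> vertex_pairs n" "std_ograph n E \<in> P" using E by (auto simp: std_edges_def)
  let ?H = "induced_subgraph (std_ograph n E) (\<phi> ` {1..m})"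
  have H: "?H \<in> P" using P Ep(2) \<phi>(2) by (simp add: hereditary_def)
  have inj: "inj_on \<phi> {1..m}" using \<phi>(1) by (rule strict_mono_on_imp_inj_on)
  have le: "i \<le> j \<longleftrightarrow> \<phi> i \<le> \<phi> j" if "i \<in> {1..m}" "j \<in> {1..m}" for i j
    using strict_mono_on_leD[OF \<phi>(1)] strict_mono_onD[OF \<phi>(1)] that by (metis leD le_less_linear)
  have edge': "{i, j} \<in> F \<longleftrightarrow> {\<phi> i, \<phi> j} \<in> E" if ij: "i \<in> {1..m}" "j \<in> {1..m}" for i j
  proof (cases i j rule: linorder_cases)
    case less
    then show ?thesis using edge[of i j] ij by simp
  next
    case greater
    then show ?thesis using edge[of j i] ij by (simp add: insert_commute)
  next
    case equal
    have "{i, j} \<notin> F" using F equal doubleton_in_vertex_pairs[of i j] by blast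
    moreover have "{\<phi> i, \<phi> j} \<notin> E" using Ep(1) equal doubleton_in_vertex_pairs[of "\<phi> i" "\<phi> j"] by blast
    ultimately show ?thesis by simp
  qed
  have "ograph_iso (std_ograph m F) ?H"
    unfolding ograph_iso_def
  proof (intro exI[of _ \<phi>] conjI ballI)
    show "bij_betw \<phi> (verts (std_ograph m F)) (verts ?H)"
      using inj by (simp add: bij_betw_def induced_subgraph_def)
    fix u v assume uv: "u \<in> verts (std_ograph m F)" "v \<in> verts (std_ograph m F)"
    then have "\<phi> u \<in> {1..n}" "\<phi> v \<in> {1..n}" using \<phi>(2) by (simp_all add: image_subset_iff del: One_nat_def)
    then show "(u, v) \<in> vord (std_ograph m F) \<longleftrightarrow> (\<phi> u, \<phi> v) \<in> vord ?H"
      using le[of u v] uv by (auto simp: induced_subgraph_def)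
    show "{u, v} \<in> edges (std_ograph m F) \<longleftrightarrow> {\<phi> u, \<phi> v} \<in> edges ?H"
      using edge'[of u v] uv by (auto simp: induced_subgraph_def)
  qed
  then show ?thesis
    using F by (intro ograph_property_iso[OF property H _ ograph_iso_sym])
      (simp_all add: ordered_graph_std_ograph)
qed

text \<open>\<open>K_{t,t}\<close> and \<open>H(\<pi>)\<close> share the shape of a left half
  followed by a right half. The embedding is therefore given by two 0-based sequences, with
  \<open>a i\<close> the place of vertex \<open>Suc i\<close> and \<open>b i\<close> the place of
  vertex \<open>Suc (k + i)\<close>.\<close>

lemma std_ograph_embedding_two_parts:
  assumes P: "hereditary P" and E: "E \<in> std_edges P n" and F: "F \<subseteq> vertex_pairs (2 * k)"
    and a: "strict_mono_on {..<k} a" "a ` {..<k} \<subseteq> {1..n}"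
    and b: "strict_mono_on {..<k} b" "b ` {..<k} \<subseteq> {1..n}"
    and ab: "\<And>i j. i < k \<Longrightarrow> j < k \<Longrightarrow> a i < b j"
    and aa_edge: "\<And>i j. i < j \<Longrightarrow> j < k \<Longrightarrow> {Suc i, Suc j} \<in> F \<longleftrightarrow> {a i, a j} \<in> E"
    and bb_edge: "\<And>i j. i < j \<Longrightarrow> j < k \<Longrightarrow> {Suc (k + i), Suc (k + j)} \<in> F \<longleftrightarrow> {b i, b j} \<in> E"
    and ab_edge: "\<And>i j. i < k \<Longrightarrow> j < k \<Longrightarrow> {Suc i, Suc (k + j)} \<in> F \<longleftrightarrow> {a i, b j} \<in> E"
  shows "std_ograph (2 * k) F \<in> P"
proof -
  define \<phi> where "\<phi> v = (if v \<le> k then a (v - 1) else b (v - 1 - k))" for v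
  show ?thesis
  proof (rule std_ograph_embedding[OF P E F, of \<phi>])
    show "strict_mono_on {1..2 * k} \<phi>"
      by (rule strict_mono_onI)
        (auto simp: \<phi>_def intro!: ab strict_mono_onD[OF a(1)] strict_mono_onD[OF b(1)])
    show "\<phi> ` {1..2 * k} \<subseteq> {1..n}"
    proof
      fix y assume "y \<in> \<phi> ` {1..2 * k}"
      then obtain v where v: "v \<in> {1..2 * k}" "y = \<phi> v" by blast
      show "y \<in> {1..n}"
      proof (cases "v \<le> k")
        case True
        then have "a (v - 1) \<in> a ` {..<k}" using v by auto
        then show ?thesis using a(2) v(2) True by (auto simp: \<phi>_def)
      next
        case False
        then have "b (v - 1 - k) \<in> b ` {..<k}" using v by (intro imageI) auto
        then show ?thesis using b(2) v(2) False by (auto simp: \<phi>_def)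
      qed
    qed
    fix i j :: nat
    assume ij: "1 \<le> i" "i < j" "j \<le> 2 * k"
    then consider "j \<le> k" | "i \<le> k" "k < j" | "k < i" by linarith
    then show "{i, j} \<in> F \<longleftrightarrow> {\<phi> i, \<phi> j} \<in> E"
    proof cases
      case 1
      then show ?thesis using aa_edge[of "i - 1" "j - 1"] ij by (simp add: \<phi>_def)
    next
      case 2
      then show ?thesis using ab_edge[of "i - 1" "j - 1 - k"] ij by (simp add: \<phi>_def)
    next
      case 3
      then show ?thesis using bb_edge[of "i - 1 - k" "j - 1 - k"] ij by (simp add: \<phi>_def)
    qed
  qed
qed

lemma enumerate_embedding:
  fixes X :: "nat set"
  assumes "finite X" "card X = t"
  obtains h where "strict_mono_on {..<t} h" "h ` {..<t} = X"
  using ex_bij_betw_strict_mono_card[OF assms(1)] assms(2) by (metis bij_betw_imp_surj_on)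

text \<open>Let \<open>s\<close> be a Ramsey number for cliques and independent sets of size
  \<open>t\<close>. In a biclique \<open>X < Y\<close> of order \<open>s\<close>, neither side
  contains a clique of size \<open>t\<close>, as this would be an induced \<open>K_t\<close>; so
  both contain independent sets of size \<open>t\<close>, and these induce
  \<open>K_{t,t}\<close>.\<close>

lemma no_biclique_if_omits_complete:
  assumes P: "hereditary P" and "omits_complete P"
  obtains s where "\<And>n E X Y. E \<in> std_edges P n \<Longrightarrow> card X = s \<Longrightarrow> card Y = s \<Longrightarrow>
    \<exists>x\<in>X. \<exists>y\<in>Y. \<not> (x < y \<and> {x, y} \<in> E)"
proof -
  obtain t where t: "complete_ograph t \<notin> P" "complete_bipartite_ograph t \<notin> P"
    using assms(2) by (auto simp: omits_complete_def)
  obtain s where "s \<ge> 1" and s: "\<And>(V :: nat set) E. finite V \<Longrightarrow> card V \<ge> s \<Longrightarrow>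
      \<exists>R\<subseteq>V. card R = t \<and> clique R E \<or> card R = t \<and> indep R E"
    using ramsey2[of t t] by blast
  show ?thesis
  proof (rule that, rule ccontr)
    fix n E and X Y :: "nat set"
    assume E: "E \<in> std_edges P n" and card: "card X = s" "card Y = s"
      and "\<not> (\<exists>x\<in>X. \<exists>y\<in>Y. \<not> (x < y \<and> {x, y} \<in> E))"
    then have XY: "\<And>x y. x \<in> X \<Longrightarrow> y \<in> Y \<Longrightarrow> x < y \<and> {x, y} \<in> E" by blast
    have Ep: "E \<subseteq> vertex_pairs n" using E by (simp add: std_edges_def)
    \<comment> \<open>A positive cardinality rules out infinite \<open>X\<close> and
      \<open>Y\<close>, whose \<open>card\<close> is 0. Moreover, as the opposite side is nonempty,
      every vertex is an endpoint of an edge and so lies in \<open>{1..n}\<close>.\<close>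
    have fin: "finite X" "finite Y" using card \<open>s \<ge> 1\<close> by (auto intro: card_ge_0_finite)
    have "X \<noteq> {}" "Y \<noteq> {}" using card \<open>s \<ge> 1\<close> by auto
    then have sub: "X \<subseteq> {1..n}" "Y \<subseteq> {1..n}"
      using XY Ep doubleton_in_vertex_pairs by blast+
    have independent: "\<exists>Z\<subseteq>W. card Z = t \<and> indep Z E" if W: "finite W" "card W = s" "W \<subseteq> {1..n}" for W
    proof (rule ccontr)
      assume "\<not> ?thesis"
      then obtain R where R: "R \<subseteq> W" "card R = t" "clique R E"
        using s[of W E] W by blast
      obtain h where h: "strict_mono_on {..<t} h" "h ` {..<t} = R"
        using enumerate_embedding[of R t] R W finite_subset by blast
      define \<phi> where "\<phi> i = h (i - 1)" for i
      have \<phi>: "strict_mono_on {1..t} \<phi>"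
        by (rule strict_mono_onI) (auto simp: \<phi>_def intro!: strict_mono_onD[OF h(1)])
      have \<phi>R: "\<phi> i \<in> R" if "i \<in> {1..t}" for i
        using that h(2) unfolding \<phi>_def by (metis One_nat_def atLeastAtMost_iff diff_less imageI le_less_trans
          lessThan_iff less_le_trans less_one not_le zero_less_one diff_Suc_less Suc_le_eq)
      have "complete_ograph t \<in> P"
        unfolding complete_ograph_def vertex_pairs_def[symmetric]
      proof (rule std_ograph_embedding[OF P E _ \<phi>])
        show "\<phi> ` {1..t} \<subseteq> {1..n}" using \<phi>R R(1) W(3) by blast
        fix i j :: nat assume ij: "1 \<le> i" "i < j" "j \<le> t"
        then have "\<phi> i < \<phi> j" by (intro strict_mono_onD[OF \<phi>]) auto
        then have "{\<phi> i, \<phi> j} \<in> E" using R(3) \<phi>R ij by (auto simp: clique_def)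
        then show "{i, j} \<in> vertex_pairs t \<longleftrightarrow> {\<phi> i, \<phi> j} \<in> E"
          using ij by (simp add: doubleton_in_vertex_pairs)
      qed simp
      with t show False by simp
    qed
    obtain X' where X': "X' \<subseteq> X" "card X' = t" "indep X' E" using independent fin card sub by blast
    obtain Y' where Y': "Y' \<subseteq> Y" "card Y' = t" "indep Y' E" using independent fin card sub by blast
    obtain a where a: "strict_mono_on {..<t} a" "a ` {..<t} = X'"
      using enumerate_embedding X' fin finite_subset by metis
    obtain b where b: "strict_mono_on {..<t} b" "b ` {..<t} = Y'"
      using enumerate_embedding Y' fin finite_subset by metis
    have aX: "a i \<in> X'" and bY: "b i \<in> Y'" if "i < t" for i using a b that by auto
    have "complete_bipartite_ograph t \<in> P"
      unfolding complete_bipartite_ograph_def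
    proof (rule std_ograph_embedding_two_parts[OF P E _ a(1) _ b(1)])
      show "{{i, j} |i j. i \<in> {1..t} \<and> j \<in> {t<..2 * t}} \<subseteq> vertex_pairs (2 * t)"
        by (auto simp: doubleton_in_vertex_pairs)
      show "a ` {..<t} \<subseteq> {1..n}" "b ` {..<t} \<subseteq> {1..n}" using a(2) b(2) X'(1) Y'(1) sub by blast+
      show "a i < b j" if "i < t" "j < t" for i j using aX bY that X'(1) Y'(1) XY by blast
      fix i j :: nat
      show "{Suc i, Suc j} \<in> {{i, j} |i j. i \<in> {1..t} \<and> j \<in> {t<..2 * t}} \<longleftrightarrow> {a i, a j} \<in> E"
        if "i < j" "j < t"
      proof -
        have "a i < a j" using that by (intro strict_mono_onD[OF a(1)]) auto
        then have "{a i, a j} \<notin> E" using X'(3) aX that unfolding indep_def by simp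
        then show ?thesis using that by (auto simp: doubleton_eq_iff)
      qed
      show "{Suc (t + i), Suc (t + j)} \<in> {{i, j} |i j. i \<in> {1..t} \<and> j \<in> {t<..2 * t}} \<longleftrightarrow> {b i, b j} \<in> E"
        if "i < j" "j < t"
      proof -
        have "b i < b j" using that by (intro strict_mono_onD[OF b(1)]) auto
        then have "{b i, b j} \<notin> E" using Y'(3) bY that unfolding indep_def by simp
        then show ?thesis using that by (auto simp: doubleton_eq_iff)
      qed
      show "{Suc i, Suc (t + j)} \<in> {{i, j} |i j. i \<in> {1..t} \<and> j \<in> {t<..2 * t}} \<longleftrightarrow> {a i, b j} \<in> E"
        if "i < t" "j < t"
      proof -
        have "{a i, b j} \<in> E" using XY aX bY that X'(1) Y'(1) by blast
        moreover have "{Suc i, Suc (t + j)} \<in> {{i, j} |i j. i \<in> {1..t} \<and> j \<in> {t<..2 * t}}"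
          using that by (intro CollectI exI conjI refl) auto
        ultimately show ?thesis by simp
      qed
    qed
    with t show False by simp
  qed
qed

section \<open>Exponential bound when some permutation graph is missing\<close>

lemma permutes_shift:
  assumes p: "p permutes {1..k :: nat}"
  shows "(\<lambda>i. p (Suc i) - 1) permutes {..<k}"
proof (rule bij_imp_permutes)
  have pin: "p (Suc i) \<in> {1..k}" if "i < k" for i
    using permutes_in_image[OF p, of "Suc i"] that by simp
  have inj: "inj_on (\<lambda>i. p (Suc i) - 1) {..<k}"
  proof (rule inj_onI)
    fix i j assume ij: "i \<in> {..<k}" "j \<in> {..<k}" "p (Suc i) - 1 = p (Suc j) - 1"
    then have "p (Suc i) \<ge> 1" "p (Suc j) \<ge> 1" using pin[of i] pin[of j] by simp_all
    with ij(3) have "p (Suc i) = p (Suc j)" by linarith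
    then show "i = j" using permutes_inj[OF p] by (simp add: inj_eq)
  qed
  moreover have "(\<lambda>i. p (Suc i) - 1) ` {..<k} \<subseteq> {..<k}"
    using pin by fastforce
  ultimately show "bij_betw (\<lambda>i. p (Suc i) - 1) {..<k} {..<k}"
    using endo_inj_surj[of "{..<k}"] by (simp add: bij_betw_def)
  show "p (Suc x) - 1 = x" if "x \<notin> {..<k}" for x
    using permutes_not_in[OF p, of "Suc x"] that by simp
qed

text \<open>A graph of \<open>P\<close> containing the blow-up would yield an induced
  \<open>H(p)\<close>, so the edge relations of all graphs in \<open>P\<close> are among the
  avoiding graphs. The exponent has \<open>Suc n\<close> because the vertices \<open>{1..n}\<close>
  are viewed inside \<open>{..<Suc n}\<close>.\<close>

theorem card_std_edges_le:
  assumes P: "hereditary P" and "omits_complete P"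
    and p: "p permutes {1..k}" and notin: "perm_ograph k p \<notin> P"
  shows "\<exists>D. \<forall>n. card (std_edges P n) \<le> 2 ^ (D * Suc n)"
proof -
  obtain s where s: "\<And>n E X Y. E \<in> std_edges P n \<Longrightarrow> card X = s \<Longrightarrow> card Y = s \<Longrightarrow>
      \<exists>x\<in>X. \<exists>y\<in>Y. \<not> (x < y \<and> {x, y} \<in> E)"
    using no_biclique_if_omits_complete[OF assms(1,2)] by metis
  define q where "q i = p (Suc i) - 1" for i
  have q: "q permutes {..<k}" using permutes_shift[OF p] by (simp add: q_def[abs_def])
  obtain N where N: "\<And>adj. symp adj \<Longrightarrow>
    (\<And>X Y. card X = s \<Longrightarrow> card Y = s \<Longrightarrow> \<exists>x\<in>X. \<exists>y\<in>Y. \<not> (x < y \<and> adj x y)) \<Longrightarrow>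
    graph_contains {(x, y). adj x y} (k * N) (blow_up k N q) \<Longrightarrow>
    \<exists>a b. strict_mono_on {..<k} a \<and> strict_mono_on {..<k} b \<and> (\<forall>i<k. \<forall>j<k. a i < b j) \<and>
      (\<forall>i<k. \<forall>j<k. i \<noteq> j \<longrightarrow> \<not> adj (a i) (a j) \<and> \<not> adj (b i) (b j)) \<and>
      (\<forall>i<k. \<forall>j<k. adj (a i) (b j) \<longleftrightarrow> j = q i)"
    using induced_pattern_if_blow_up[OF q, of s] by blast
  let ?\<sigma> = "blow_up k N q"
  have avoid: "\<not> graph_contains {(x, y). {x, y} \<in> E} (k * N) ?\<sigma>" if E: "E \<in> std_edges P n" for E n
  proof
    assume contains: "graph_contains {(x, y). {x, y} \<in> E} (k * N) ?\<sigma>"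
    have "symp (\<lambda>x y. {x, y} \<in> E)" by (auto intro!: sympI simp: insert_commute)
    then have "\<exists>a b. strict_mono_on {..<k} a \<and> strict_mono_on {..<k} b \<and> (\<forall>i<k. \<forall>j<k. a i < b j) \<and>
        (\<forall>i<k. \<forall>j<k. i \<noteq> j \<longrightarrow> {a i, a j} \<notin> E \<and> {b i, b j} \<notin> E) \<and>
        (\<forall>i<k. \<forall>j<k. {a i, b j} \<in> E \<longleftrightarrow> j = q i)"
      by (rule N[OF _ _ contains]) (rule s[OF E])
    then obtain a b where a: "strict_mono_on {..<k} a" and b: "strict_mono_on {..<k} b"
      and *: "\<forall>i<k. \<forall>j<k. a i < b j"
        "\<forall>i<k. \<forall>j<k. i \<noteq> j \<longrightarrow> {a i, a j} \<notin> E \<and> {b i, b j} \<notin> E"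
        "\<forall>i<k. \<forall>j<k. {a i, b j} \<in> E \<longleftrightarrow> j = q i"
      by (elim exE conjE)
    note ab = *(1)[rule_format] and non_edge = *(2)[rule_format] and edge = *(3)[rule_format]
    have Ep: "E \<subseteq> vertex_pairs n" using E by (simp add: std_edges_def)
    have qk: "q i < k \<longleftrightarrow> i < k" for i by (rule permutes_lessThan_iff[OF q])
    have pq: "p (Suc i) = Suc (q i)" if "i < k" for i
      using permutes_in_image[OF p, of "Suc i"] that by (simp add: q_def)
    \<comment> \<open>Every selected vertex is an endpoint of a selected edge and hence a vertex of
      the graph.\<close>
    have a_range: "a i \<in> {1..n}" if "i < k" for i
      using edge[of i "q i"] that qk Ep doubleton_in_vertex_pairs by blast
    have b_range: "b j \<in> {1..n}" if "j < k" for j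
    proof -
      obtain i where "q i = j" using permutes_surj[OF q] by (metis surjD)
      then show ?thesis using edge[of i "q i"] that qk Ep doubleton_in_vertex_pairs by blast
    qed
    have "perm_ograph k p \<in> P"
      unfolding perm_ograph_def
    proof (rule std_ograph_embedding_two_parts[OF P E _ a _ b])
      show "{{i, p i + k} |i. i \<in> {1..k}} \<subseteq> vertex_pairs (2 * k)"
      proof clarify
        fix i assume "i \<in> {1..k}"
        then show "{i, p i + k} \<in> vertex_pairs (2 * k)"
          using permutes_in_image[OF p, of i] by (simp add: doubleton_in_vertex_pairs)
      qed
      show "a ` {..<k} \<subseteq> {1..n}" "b ` {..<k} \<subseteq> {1..n}" using a_range b_range by blast+
      show "a i < b j" if "i < k" "j < k" for i j using ab that .
      fix i j :: nat
      show "{Suc i, Suc j} \<in> {{i, p i + k} |i. i \<in> {1..k}} \<longleftrightarrow> {a i, a j} \<in> E" if "i < j" "j < k"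
      proof -
        have "{Suc i, Suc j} \<notin> {{i, p i + k} |i. i \<in> {1..k}}"
        proof
          assume "{Suc i, Suc j} \<in> {{i, p i + k} |i. i \<in> {1..k}}"
          then obtain l where l: "l \<in> {1..k}" "{Suc i, Suc j} = {l, p l + k}" by blast
          then have "Suc i > k \<or> Suc j > k" using permutes_in_image[OF p, of l] by (auto simp: doubleton_eq_iff)
          then show False using that by simp
        qed
        then show ?thesis using non_edge[of i j] that by simp
      qed
      show "{Suc (k + i), Suc (k + j)} \<in> {{i, p i + k} |i. i \<in> {1..k}} \<longleftrightarrow> {b i, b j} \<in> E" if "i < j" "j < k"
        using non_edge[of i j] that by (auto simp: doubleton_eq_iff)
      show "{Suc i, Suc (k + j)} \<in> {{i, p i + k} |i. i \<in> {1..k}} \<longleftrightarrow> {a i, b j} \<in> E" if ij: "i < k" "j < k"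
      proof -
        have "{Suc i, Suc (k + j)} \<in> {{i, p i + k} |i. i \<in> {1..k}} \<longleftrightarrow> Suc (k + j) = p (Suc i) + k"
          using ij by (auto simp: doubleton_eq_iff)
        then show ?thesis using edge[OF ij] pq[OF ij(1)] by auto
      qed
    qed
    with notin show False ..
  qed
  obtain D where D: "\<And>n. card (avoiding_graphs (k * N) ?\<sigma> n) \<le> 2 ^ (D * n)"
    using card_avoiding_graphs_le[OF blow_up_permutes[OF q]] by blast
  have "card (std_edges P n) \<le> 2 ^ (D * Suc n)" for n
  proof -
    define \<rho> where "\<rho> E = {(x, y). x < y \<and> {x, y} \<in> E}" for E :: "nat set set"
    have "inj_on \<rho> (std_edges P n)"
    proof (rule inj_onI)
      fix E F assume E: "E \<in> std_edges P n" and F: "F \<in> std_edges P n" and eq: "\<rho> E = \<rho> F"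
      show "E = F"
      proof (rule vertex_pairs_ext)
        show "{u, v} \<in> E \<longleftrightarrow> {u, v} \<in> F" if "u < v" for u v
          using eq that unfolding \<rho>_def by blast
      qed (use E F in \<open>auto simp: std_edges_def\<close>)
    qed
    moreover have "\<rho> ` std_edges P n \<subseteq> avoiding_graphs (k * N) ?\<sigma> (Suc n)"
    proof
      fix R assume "R \<in> \<rho> ` std_edges P n"
      then obtain E where E: "E \<in> std_edges P n" and R: "R = \<rho> E" by blast
      have "\<not> graph_contains R (k * N) ?\<sigma>"
        using avoid[OF E] graph_contains_mono[of R "k * N" ?\<sigma> "{(x, y). {x, y} \<in> E}"] by (auto simp: R \<rho>_def)
      moreover have "b \<le> n" if "{a, b} \<in> E" for a b
      proof -
        have "{a, b} \<in> vertex_pairs n" using E that by (auto simp: std_edges_def)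
        then show ?thesis by (simp add: doubleton_in_vertex_pairs)
      qed
      then have "R \<subseteq> {(a, b). a < b \<and> b < Suc n}"
        unfolding R \<rho>_def by (auto simp: less_Suc_eq_le)
      ultimately show "R \<in> avoiding_graphs (k * N) ?\<sigma> (Suc n)" by (simp add: avoiding_graphs_def)
    qed
    ultimately have "card (std_edges P n) \<le> card (avoiding_graphs (k * N) ?\<sigma> (Suc n))"
      using finite_avoiding_graphs by (rule card_inj_on_le)
    with D[of "Suc n"] show ?thesis by linarith
  qed
  then show ?thesis by blast
qed

section \<open>Split matchings\<close>

text \<open>For edges \<open>(a, b)\<close> and \<open>(c, d)\<close> written from left to right,
  the requirement that \<open>a\<close> strictly precedes \<open>d\<close> puts all left endpoints
  before all right endpoints, and \<open>a = c \<longleftrightarrow> b = d\<close> makes the edges a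
  matching. A condition on pairs of edges passes to induced subgraphs at once; it refers to
  \<open>vord\<close> because vertex labels need not follow the order.\<close>

definition split_matching :: "nat ograph \<Rightarrow> bool" where
  "split_matching G \<longleftrightarrow> ordered_graph G \<and>
     (\<forall>a b c d. {a, b} \<in> edges G \<and> {c, d} \<in> edges G \<and> (a, b) \<in> vord G \<and> (c, d) \<in> vord G \<longrightarrow>
        (a, d) \<in> vord G \<and> a \<noteq> d \<and> (a = c \<longleftrightarrow> b = d))"

definition split_matching_edges :: "nat \<Rightarrow> nat set set set" where
  "split_matching_edges n = {E. E \<subseteq> vertex_pairs n \<and>
     (\<forall>a b c d. {a, b} \<in> E \<and> {c, d} \<in> E \<and> a < b \<and> c < d \<longrightarrow> a < d \<and> (a = c \<longleftrightarrow> b = d))}"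

lemma split_matching_ordered: "split_matching G \<Longrightarrow> ordered_graph G"
  unfolding split_matching_def by (rule conjunct1)

lemma split_matching_edges_vertex_pairs: "E \<in> split_matching_edges n \<Longrightarrow> E \<subseteq> vertex_pairs n"
  unfolding split_matching_edges_def mem_Collect_eq by (rule conjunct1)

lemma ordered_graph_edge_in_verts:
  assumes "ordered_graph G" "{a, b} \<in> edges G"
  shows "a \<in> verts G" "b \<in> verts G" "a \<noteq> b"
  using assms by (auto simp: ordered_graph_def)

lemma split_matching_std_ograph:
  assumes E: "E \<subseteq> vertex_pairs n"
  shows "split_matching (std_ograph n E) \<longleftrightarrow> E \<in> split_matching_edges n"
proof -
  have e: "{a, b} \<in> E \<longleftrightarrow> {a, b} \<in> E \<and> a \<in> {1..n} \<and> b \<in> {1..n} \<and> a \<noteq> b" for a b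
    using E doubleton_in_vertex_pairs by blast
  have "(\<forall>a b c d. {a, b} \<in> E \<and> {c, d} \<in> E \<and> a < b \<and> c < d \<longrightarrow> a < d \<and> (a = c \<longleftrightarrow> b = d)) \<longleftrightarrow>
    (\<forall>a b c d. {a, b} \<in> E \<and> {c, d} \<in> E \<and> (a, b) \<in> vord (std_ograph n E) \<and> (c, d) \<in> vord (std_ograph n E) \<longrightarrow>
        (a, d) \<in> vord (std_ograph n E) \<and> a \<noteq> d \<and> (a = c \<longleftrightarrow> b = d))" (is "?l \<longleftrightarrow> ?r")
  proof
    assume l: ?l
    show ?r
    proof (intro allI impI)
      fix a b c d
      assume *: "{a, b} \<in> E \<and> {c, d} \<in> E \<and> (a, b) \<in> vord (std_ograph n E) \<and> (c, d) \<in> vord (std_ograph n E)"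
      then have "a < b" "c < d" using e[of a b] e[of c d] by auto
      then have "a < d \<and> (a = c \<longleftrightarrow> b = d)" using l * by blast
      then show "(a, d) \<in> vord (std_ograph n E) \<and> a \<noteq> d \<and> (a = c \<longleftrightarrow> b = d)" using * by simp
    qed
  next
    assume r: ?r
    show ?l
    proof (intro allI impI)
      fix a b c d
      assume *: "{a, b} \<in> E \<and> {c, d} \<in> E \<and> a < b \<and> c < d"
      then have "(a, b) \<in> vord (std_ograph n E)" "(c, d) \<in> vord (std_ograph n E)"
        using e[of a b] e[of c d] by simp_all
      then have "(a, d) \<in> vord (std_ograph n E) \<and> a \<noteq> d \<and> (a = c \<longleftrightarrow> b = d)" using r * by blast
      then show "a < d \<and> (a = c \<longleftrightarrow> b = d)" by simp
    qed
  qed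
  then show ?thesis
    using E by (simp add: split_matching_def split_matching_edges_def ordered_graph_std_ograph)
qed

lemma split_matching_induced_subgraph:
  assumes "split_matching G" "S \<subseteq> verts G"
  shows "split_matching (induced_subgraph G S)"
proof -
  have G: "finite (verts G)" "edges G \<subseteq> {e. e \<subseteq> verts G \<and> card e = 2}" "linear_order_on (verts G) (vord G)"
    using split_matching_ordered[OF assms(1)] by (simp_all add: ordered_graph_def)
  have "linear_order_on S (vord G \<inter> S \<times> S)"
    using G(3) assms(2) unfolding linear_order_on_def partial_order_on_def preorder_on_def
    by (auto simp: refl_on_def total_on_def antisym_def trans_def) blast+
  then have "ordered_graph (induced_subgraph G S)"
    using G assms(2) by (auto simp: ordered_graph_def induced_subgraph_def intro: finite_subset)
  moreover have "(a, d) \<in> vord (induced_subgraph G S) \<and> a \<noteq> d \<and> (a = c \<longleftrightarrow> b = d)"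
    if "{a, b} \<in> edges (induced_subgraph G S) \<and> {c, d} \<in> edges (induced_subgraph G S) \<and>
      (a, b) \<in> vord (induced_subgraph G S) \<and> (c, d) \<in> vord (induced_subgraph G S)" for a b c d
  proof -
    have "{a, b} \<in> edges G \<and> {c, d} \<in> edges G \<and> (a, b) \<in> vord G \<and> (c, d) \<in> vord G" "a \<in> S" "d \<in> S"
      using that by (auto simp: induced_subgraph_def)
    moreover from this have "(a, d) \<in> vord G \<and> a \<noteq> d \<and> (a = c \<longleftrightarrow> b = d)"
      using assms(1) unfolding split_matching_def by blast
    ultimately show ?thesis by (simp add: induced_subgraph_def)
  qed
  ultimately show ?thesis unfolding split_matching_def by blast
qed

lemma split_matching_iso:
  assumes G: "split_matching G" and H: "ordered_graph H" and "ograph_iso G H"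
  shows "split_matching H"
proof -
  obtain f where f: "bij_betw f (verts H) (verts G)"
    and ord: "\<And>u v. u \<in> verts H \<Longrightarrow> v \<in> verts H \<Longrightarrow> (u, v) \<in> vord H \<longleftrightarrow> (f u, f v) \<in> vord G"
    and edge: "\<And>u v. u \<in> verts H \<Longrightarrow> v \<in> verts H \<Longrightarrow> {u, v} \<in> edges H \<longleftrightarrow> {f u, f v} \<in> edges G"
    using ograph_iso_sym[OF assms(3)] unfolding ograph_iso_def by blast
  have inj: "f u = f v \<longleftrightarrow> u = v" if "u \<in> verts H" "v \<in> verts H" for u v
    using that f by (meson bij_betw_imp_inj_on inj_on_eq_iff)
  have "(a, d) \<in> vord H \<and> a \<noteq> d \<and> (a = c \<longleftrightarrow> b = d)"
    if "{a, b} \<in> edges H \<and> {c, d} \<in> edges H \<and> (a, b) \<in> vord H \<and> (c, d) \<in> vord H" for a b c d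
  proof -
    have v: "a \<in> verts H" "b \<in> verts H" "c \<in> verts H" "d \<in> verts H"
      using that ordered_graph_edge_in_verts[OF H] by blast+
    then have "{f a, f b} \<in> edges G \<and> {f c, f d} \<in> edges G \<and> (f a, f b) \<in> vord G \<and> (f c, f d) \<in> vord G"
      using that ord edge by simp
    then have "(f a, f d) \<in> vord G \<and> f a \<noteq> f d \<and> (f a = f c \<longleftrightarrow> f b = f d)"
      using G unfolding split_matching_def by blast
    then show ?thesis using v ord inj by auto
  qed
  then show ?thesis using H unfolding split_matching_def by blast
qed

lemma hereditary_split_matching: "hereditary {G. split_matching G}"
  unfolding hereditary_def ograph_property_def
  using split_matching_induced_subgraph split_matching_iso split_matching_ordered by blast

lemma std_edges_split_matching: "std_edges {G. split_matching G} n = split_matching_edges n"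
  unfolding std_edges_def mem_Collect_eq
  using split_matching_std_ograph split_matching_edges_vertex_pairs by blast

text \<open>If \<open>v\<close> were the right end of one edge and the left end of the other, the
  splitting condition would give \<open>v < v\<close>. Otherwise both edges have \<open>v\<close> as
  an end of the same kind, and their other ends agree.\<close>

lemma split_matching_edges_unique:
  assumes E: "E \<in> split_matching_edges n" and uv: "{u, v} \<in> E" and wv: "{w, v} \<in> E"
  shows "u = w"
proof -
  have ne: "u \<noteq> v" "w \<noteq> v"
    using E uv wv doubleton_in_vertex_pairs unfolding split_matching_edges_def by blast+
  have split: "a < d \<and> (a = c \<longleftrightarrow> b = d)" if "{a, b} \<in> E" "{c, d} \<in> E" "a < b" "c < d" for a b c d
    using E that unfolding split_matching_edges_def by blast
  have vu: "{v, u} \<in> E" "{v, w} \<in> E" using uv wv by (simp_all add: insert_commute)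
  consider "u < v" "w < v" | "u < v" "v < w" | "v < u" "w < v" | "v < u" "v < w"
    using ne by linarith
  then show ?thesis
  proof cases
    case 1
    then show ?thesis using split[OF uv wv] by simp
  next
    case 2
    then show ?thesis using split[OF vu(2) uv] by simp
  next
    case 3
    then show ?thesis using split[OF vu(1) wv] by simp
  next
    case 4
    then show ?thesis using split[OF vu(1) vu(2)] by simp
  qed
qed

lemma omits_complete_split_matching: "omits_complete {G. split_matching G}"
proof -
  \<comment> \<open>\<open>t = 3\<close> is the least choice, as \<open>K_2\<close> is itself a
    split matching.\<close>
  have "complete_ograph 3 \<notin> {G. split_matching G}"
  proof
    assume "complete_ograph 3 \<in> {G. split_matching G}"
    then have "vertex_pairs 3 \<in> split_matching_edges 3"
      by (simp only: mem_Collect_eq complete_ograph_def vertex_pairs_def[symmetric]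
        split_matching_std_ograph[OF subset_refl])
    then show False
      using split_matching_edges_unique[of "vertex_pairs 3" 3 1 2 3] by (simp add: doubleton_in_vertex_pairs)
  qed
  moreover have "complete_bipartite_ograph 3 \<notin> {G. split_matching G}"
  proof
    let ?E = "{{i, j} |i j. i \<in> {1..3} \<and> j \<in> {3<..2 * 3 :: nat}}"
    assume "complete_bipartite_ograph 3 \<in> {G. split_matching G}"
    moreover have "?E \<subseteq> vertex_pairs (2 * 3)" by (auto simp: doubleton_in_vertex_pairs)
    ultimately have "?E \<in> split_matching_edges (2 * 3)"
      by (simp only: split_matching_std_ograph complete_bipartite_ograph_def mem_Collect_eq)
    moreover have "{1, 4} \<in> ?E" by (intro CollectI exI[of _ 1] exI[of _ 4]) simp
    moreover have "{2, 4} \<in> ?E" by (intro CollectI exI[of _ 2] exI[of _ 4]) simp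
    ultimately have "1 = (2 :: nat)" by (rule split_matching_edges_unique)
    then show False by simp
  qed
  ultimately show ?thesis unfolding omits_complete_def by blast
qed

text \<open>Let \<open>p\<close> be the involution exchanging matched partners and fixing isolated
  vertices, and let \<open>m\<close> be the last left endpoint. In \<open>H(p)\<close> on
  \<open>2 * n\<close> vertices take the left copy of each vertex up to \<open>m\<close> and the
  right copy of each later one. Then \<open>i\<close> and \<open>n + j\<close> are adjacent iff
  \<open>p i = j\<close>, which for \<open>i < j\<close> means that \<open>{i, j}\<close> is an
  edge. An isolated vertex loses its only neighbour, its own other copy.\<close>

lemma split_matching_in_if_perm_graphs:
  assumes P: "hereditary P" and perm: "\<And>k p. p permutes {1..k} \<Longrightarrow> perm_ograph k p \<in> P"
    and E: "E \<in> split_matching_edges n"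
  shows "std_ograph n E \<in> P"
proof -
  have Ep: "E \<subseteq> vertex_pairs n" using E by (simp add: split_matching_edges_def)
  have split: "a < d \<and> (a = c \<longleftrightarrow> b = d)" if "{a, b} \<in> E" "{c, d} \<in> E" "a < b" "c < d" for a b c d
    using E that unfolding split_matching_edges_def by blast
  have uniq: "u = w" if "{v, u} \<in> E" "{v, w} \<in> E" for u v w
    using split_matching_edges_unique[OF E, of u v w] that by (simp add: insert_commute)
  have range: "u \<in> {1..n}" "v \<in> {1..n}" "u \<noteq> v" if "{u, v} \<in> E" for u v
    using that Ep doubleton_in_vertex_pairs by blast+
  define p where "p v = (if \<exists>u. {v, u} \<in> E then THE u. {v, u} \<in> E else v)" for v
  have p_edge: "p v = u" if "{v, u} \<in> E" for u v
    using that uniq unfolding p_def by (auto intro!: the_equality)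
  have p_iff: "p v = u \<longleftrightarrow> {v, u} \<in> E" if "u \<noteq> v" for u v
    using p_edge[of v u] that by (metis p_def p_edge)
  have "p (p v) = v" for v
  proof (cases "p v = v")
    case False
    then have "{v, p v} \<in> E" using p_iff by blast
    then show ?thesis using p_edge[of "p v" v] by (simp add: insert_commute)
  qed simp
  moreover have "p v = v" if "v \<notin> {1..n}" for v using that range p_iff by blast
  ultimately have p: "p permutes {1..n}" unfolding permutes_def by metis
  define F where "F = {{i, p i + n} |i. i \<in> {1..n}}"
  have p_range: "p i \<in> {1..n}" if "i \<in> {1..n}" for i using permutes_in_image[OF p] that by blast
  have "F \<subseteq> vertex_pairs (2 * n)"
    unfolding F_def
  proof clarify
    fix i assume "i \<in> {1..n}"
    then show "{i, p i + n} \<in> vertex_pairs (2 * n)"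
      using p_range[of i] by (simp add: doubleton_in_vertex_pairs)
  qed
  then have F: "F \<in> std_edges P (2 * n)"
    using perm[OF p] by (simp add: perm_ograph_def std_edges_def F_def)
  define L where "L = {a \<in> {1..n}. \<exists>b>a. {a, b} \<in> E}"
  have finL: "finite (insert 0 L)" by (simp add: L_def)
  \<comment> \<open>The element 0 gives \<open>m = 0\<close> when there are no edges; all vertices
    are then taken on the right.\<close>
  define m where "m = Max (insert 0 L)"
  have left: "a \<le> m" if "{a, b} \<in> E" "a < b" for a b
    using that range[OF that(1)] finL by (auto simp: m_def L_def intro!: Max_ge)
  have right: "m < b" if ab: "{a, b} \<in> E" "a < b" for a b
  proof -
    have "m \<in> insert 0 L" unfolding m_def using finL by (intro Max_in) auto
    then show ?thesis
    proof
      assume "m = 0"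
      then show ?thesis using ab by simp
    next
      assume "m \<in> L"
      then show ?thesis using split ab unfolding L_def by blast
    qed
  qed
  define \<phi> where "\<phi> v = (if v \<le> m then v else n + v)" for v
  show ?thesis
  proof (rule std_ograph_embedding[OF P F Ep])
    show "strict_mono_on {1..n} \<phi>" by (rule strict_mono_onI) (auto simp: \<phi>_def)
    show "\<phi> ` {1..n} \<subseteq> {1..2 * n}" by (auto simp: \<phi>_def)
    fix i j :: nat assume ij: "1 \<le> i" "i < j" "j \<le> n"
    consider "j \<le> m" | "i \<le> m" "m < j" | "m < i" by linarith
    then show "{i, j} \<in> E \<longleftrightarrow> {\<phi> i, \<phi> j} \<in> F"
    proof cases
      case 1
      then have "{i, j} \<notin> E" using right[of i j] ij by auto
      moreover have "{i, j} \<notin> F" using p_range ij by (force simp: F_def doubleton_eq_iff)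
      ultimately show ?thesis using 1 ij by (simp add: \<phi>_def)
    next
      case 2
      have "{i, n + j} \<in> F \<longleftrightarrow> p i = j" using ij by (auto simp: F_def doubleton_eq_iff)
      also have "\<dots> \<longleftrightarrow> {i, j} \<in> E" using p_iff[of j i] ij by simp
      finally show ?thesis using 2 by (simp add: \<phi>_def)
    next
      case 3
      then have "{i, j} \<notin> E" using left[of i j] ij by auto
      moreover have "{n + i, n + j} \<notin> F" using ij by (auto simp: F_def doubleton_eq_iff)
      ultimately show ?thesis using 3 ij by (simp add: \<phi>_def)
    qed
  qed
qed

section \<open>Graphs of maximum degree at most one\<close>

text \<open>Uniqueness of neighbours can be transported along an isomorphism without comparing
  cardinalities of edge sets.\<close>

lemma max_degree_le_1_iff:
  assumes G: "ordered_graph G"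
  shows "(\<forall>v\<in>verts G. degree G v \<le> 1) \<longleftrightarrow>
    (\<forall>v\<in>verts G. \<forall>u\<in>verts G. \<forall>w\<in>verts G. {v, u} \<in> edges G \<and> {v, w} \<in> edges G \<longrightarrow> u = w)"
proof (rule ball_cong[OF refl])
  fix v assume v: "v \<in> verts G"
  have "edges G \<subseteq> Pow (verts G)" "finite (verts G)" using G by (auto simp: ordered_graph_def)
  then have fin: "finite (edges G)" using finite_subset by blast
  have other: "\<exists>u\<in>verts G. e = {v, u}" if "e \<in> edges G" "v \<in> e" for e
  proof -
    have "card e = 2" "e \<subseteq> verts G" using that G by (auto simp: ordered_graph_def)
    with that(2) show ?thesis by (auto simp: card_2_iff)
  qed
  have "degree G v \<le> 1 \<longleftrightarrow> (\<forall>e\<in>edges G. \<forall>e'\<in>edges G. v \<in> e \<and> v \<in> e' \<longrightarrow> e = e')"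
    unfolding degree_def using fin by (auto simp: card_le_Suc0_iff_eq)
  also have "\<dots> \<longleftrightarrow> (\<forall>u\<in>verts G. \<forall>w\<in>verts G. {v, u} \<in> edges G \<and> {v, w} \<in> edges G \<longrightarrow> u = w)"
  proof (intro iffI ballI impI)
    fix u w
    assume *: "\<forall>e\<in>edges G. \<forall>e'\<in>edges G. v \<in> e \<and> v \<in> e' \<longrightarrow> e = e'"
      and uw: "{v, u} \<in> edges G \<and> {v, w} \<in> edges G"
    have "{v, u} = {v, w}" by (rule *[rule_format]) (use uw in simp_all)
    then show "u = w" by (auto simp: doubleton_eq_iff)
  next
    fix e e'
    assume *: "\<forall>u\<in>verts G. \<forall>w\<in>verts G. {v, u} \<in> edges G \<and> {v, w} \<in> edges G \<longrightarrow> u = w"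
      and e: "e \<in> edges G" "e' \<in> edges G" "v \<in> e \<and> v \<in> e'"
    obtain u where u: "u \<in> verts G" "e = {v, u}" using other[OF e(1) conjunct1[OF e(3)]] by blast
    obtain w where w: "w \<in> verts G" "e' = {v, w}" using other[OF e(2) conjunct2[OF e(3)]] by blast
    have "u = w" by (rule *[rule_format, OF u(1) w(1)]) (use e u w in simp)
    with u w show "e = e'" by simp
  qed
  finally show "degree G v \<le> 1 \<longleftrightarrow>
    (\<forall>u\<in>verts G. \<forall>w\<in>verts G. {v, u} \<in> edges G \<and> {v, w} \<in> edges G \<longrightarrow> u = w)" .
qed

text \<open>Closure under isomorphism is what counting by standard representatives requires.\<close>

lemma ograph_property_max_degree_le_1:
  assumes P: "ograph_property P"
  shows "ograph_property (max_degree_le_1 P)"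
  unfolding ograph_property_def
proof (intro conjI ballI allI impI)
  show "ordered_graph G" if "G \<in> max_degree_le_1 P" for G
    using that ograph_property_ordered[OF P] by (simp add: max_degree_le_1_def)
  fix G H :: "nat ograph"
  assume G: "G \<in> max_degree_le_1 P" and H: "ordered_graph H \<and> ograph_iso G H"
  have GP: "G \<in> P" "\<forall>v\<in>verts G. degree G v \<le> 1" using G by (auto simp: max_degree_le_1_def)
  have HP: "H \<in> P" using ograph_property_iso[OF P GP(1)] H by blast
  obtain f where f: "bij_betw f (verts H) (verts G)"
    and edge: "\<And>u v. u \<in> verts H \<Longrightarrow> v \<in> verts H \<Longrightarrow> {u, v} \<in> edges H \<longleftrightarrow> {f u, f v} \<in> edges G"
    using ograph_iso_sym[OF conjunct2[OF H]] unfolding ograph_iso_def by blast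
  have fG: "f v \<in> verts G" if "v \<in> verts H" for v using that f by (metis bij_betwE)
  have inj: "f u = f v \<Longrightarrow> u = v" if "u \<in> verts H" "v \<in> verts H" for u v
    using that f by (meson bij_betw_imp_inj_on inj_onD)
  have "\<forall>v\<in>verts H. \<forall>u\<in>verts H. \<forall>w\<in>verts H. {v, u} \<in> edges H \<and> {v, w} \<in> edges H \<longrightarrow> u = w"
  proof (intro ballI impI)
    fix v u w assume *: "v \<in> verts H" "u \<in> verts H" "w \<in> verts H" "{v, u} \<in> edges H \<and> {v, w} \<in> edges H"
    then have "{f v, f u} \<in> edges G \<and> {f v, f w} \<in> edges G" using edge by simp
    then have "f u = f w"
      using GP(2) max_degree_le_1_iff[OF ograph_property_ordered[OF P GP(1)]] fG * by blast
    then show "u = w" using inj * by blast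
  qed
  then show "H \<in> max_degree_le_1 P"
    using HP H max_degree_le_1_iff unfolding max_degree_le_1_def by blast
qed

lemma split_matching_edges_max_degree:
  assumes E: "E \<in> split_matching_edges n" and P: "std_ograph n E \<in> P"
  shows "std_ograph n E \<in> max_degree_le_1 P"
proof -
  have "ordered_graph (std_ograph n E)"
    using E by (simp add: ordered_graph_std_ograph split_matching_edges_def)
  moreover have "u = w" if "{v, u} \<in> E \<and> {v, w} \<in> E" for u v w
    using split_matching_edges_unique[OF E, of u v w] that by (simp add: insert_commute)
  ultimately have "\<forall>v\<in>verts (std_ograph n E). degree (std_ograph n E) v \<le> 1"
    by (subst max_degree_le_1_iff) auto
  then show ?thesis using P unfolding max_degree_le_1_def by blast
qed

section \<open>The minimal speed\<close>

text \<open>A split matching is determined by the set \<open>S\<close> of its \<open>2 * k\<close>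
  non-isolated vertices and a permutation: the left endpoints are the first \<open>k\<close>
  elements of \<open>S\<close>, the right endpoints the last \<open>k\<close>. As
  \<open>enumerate\<close> counts from 0, position \<open>k + p i\<close> holds the right endpoint
  with index \<open>p i\<close>.\<close>

definition matching_of :: "nat set \<Rightarrow> (nat \<Rightarrow> nat) \<Rightarrow> nat set set" where
  "matching_of S p =
     (\<lambda>i. {enumerate S i, enumerate S (card S div 2 + p i)}) ` {..<card S div 2}"

definition matching_codes :: "nat \<Rightarrow> (nat set \<times> (nat \<Rightarrow> nat)) set" where
  "matching_codes n =
     (SIGMA S:{S. S \<subseteq> {1..n} \<and> even (card S)}. {p. p permutes {..<card S div 2}})"

lemma card_matching_codes: "card (matching_codes n) = min_speed n"
proof -
  let ?A = "{S. S \<subseteq> {1..n} \<and> even (card S)}"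
  have fin: "finite ?A" by (rule finite_subset[of _ "Pow {1..n}"]) auto
  have le: "card S \<le> n" if "S \<subseteq> {1..n}" for S
    using card_mono[OF _ that] by simp
  have "card (matching_codes n) = (\<Sum>S\<in>?A. card {p. p permutes {..<card S div 2}})"
    unfolding matching_codes_def using fin by (intro card_SigmaI) (auto simp: finite_permutations)
  also have "\<dots> = (\<Sum>S\<in>?A. fact (card S div 2))"
    by (simp add: card_permutations)
  also have "\<dots> = (\<Sum>k\<in>{0..n div 2}. \<Sum>S\<in>{S \<in> ?A. card S div 2 = k}. fact (card S div 2))"
    using fin le by (intro sum.group[symmetric]) (auto intro!: div_le_mono)
  also have "\<dots> = (\<Sum>k\<in>{0..n div 2}. (n choose (2 * k)) * fact k)"
  proof (rule sum.cong[OF refl])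
    fix k
    have "{S \<in> ?A. card S div 2 = k} = {S. S \<subseteq> {1..n} \<and> card S = 2 * k}" by auto
    then show "(\<Sum>S\<in>{S \<in> ?A. card S div 2 = k}. fact (card S div 2)) = (n choose (2 * k)) * fact k"
      using n_subsets[of "{1..n}" "2 * k"] by simp
  qed
  finally show ?thesis by (simp add: min_speed_def)
qed

lemma enumerate_less_iff:
  assumes "finite S" "i < card S" "j < card S"
  shows "enumerate S i < enumerate S j \<longleftrightarrow> i < j"
  using assms finite_enumerate_mono[of _ _ S] by (metis linorder_neq_iff order_less_asym)

lemma enumerate_eq_iff:
  assumes "finite S" "i < card S" "j < card S"
  shows "enumerate S i = enumerate S j \<longleftrightarrow> i = j"
  using enumerate_less_iff[OF assms] enumerate_less_iff[OF assms(1,3,2)] by (metis linorder_neq_iff less_irrefl)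

lemma matching_codesE:
  assumes "(S, p) \<in> matching_codes n"
  obtains k where "finite S" "S \<subseteq> {1..n}" "card S = 2 * k" "p permutes {..<k}"
    "matching_of S p = (\<lambda>i. {enumerate S i, enumerate S (k + p i)}) ` {..<k}"
  using assms that[of "card S div 2"] finite_subset[of S "{1..n}"]
  by (auto simp: matching_codes_def matching_of_def)

lemma matching_of_in_split_matching_edges:
  assumes "(S, p) \<in> matching_codes n"
  shows "matching_of S p \<in> split_matching_edges n"
proof -
  obtain k where S: "finite S" "S \<subseteq> {1..n}" "card S = 2 * k" and p: "p permutes {..<k}"
    and M: "matching_of S p = (\<lambda>i. {enumerate S i, enumerate S (k + p i)}) ` {..<k}"
    using assms by (rule matching_codesE)
  have pk: "p i < k \<longleftrightarrow> i < k" for i by (rule permutes_lessThan_iff[OF p])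
  have hS: "enumerate S i \<in> {1..n}" if "i < 2 * k" for i
  proof -
    have "enumerate S i \<in> S" using finite_enumerate_in_set[OF S(1)] that S(3) by simp
    then show ?thesis using S(2) by blast
  qed
  have less: "enumerate S i < enumerate S (k + p j)" if "i < k" "j < k" for i j
    using enumerate_less_iff[OF S(1)] S(3) that pk[of j] by simp
  have ordered: "\<exists>i<k. a = enumerate S i \<and> b = enumerate S (k + p i)"
    if ab: "{a, b} \<in> matching_of S p" "a < b" for a b
  proof -
    obtain i where i: "i < k" "{a, b} = {enumerate S i, enumerate S (k + p i)}" using ab(1) M by auto
    then show ?thesis using less[OF i(1) i(1)] ab(2) by (auto simp: doubleton_eq_iff)
  qed
  have "matching_of S p \<subseteq> vertex_pairs n"
  proof
    fix e assume "e \<in> matching_of S p"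
    then obtain i where i: "i < k" "e = {enumerate S i, enumerate S (k + p i)}" using M by auto
    have "k + p i < 2 * k" using pk[of i] i by simp
    with i show "e \<in> vertex_pairs n"
      using hS[of i] hS[of "k + p i"] less[OF i(1) i(1)] by (auto simp: doubleton_in_vertex_pairs)
  qed
  moreover have "a < d \<and> (a = c \<longleftrightarrow> b = d)"
    if abcd: "{a, b} \<in> matching_of S p \<and> {c, d} \<in> matching_of S p \<and> a < b \<and> c < d" for a b c d
  proof -
    obtain i where i: "i < k" "a = enumerate S i" "b = enumerate S (k + p i)"
      using ordered[of a b] abcd by blast
    obtain j where j: "j < k" "c = enumerate S j" "d = enumerate S (k + p j)"
      using ordered[of c d] abcd by blast
    have "a = c \<longleftrightarrow> i = j" using enumerate_eq_iff[OF S(1)] S(3) i j by simp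
    moreover have "b = d \<longleftrightarrow> p i = p j"
      using enumerate_eq_iff[OF S(1), of "k + p i" "k + p j"] S(3) i j pk[of i] pk[of j] by simp
    ultimately show ?thesis using less[OF i(1) j(1)] i j permutes_inj[OF p] by (simp add: inj_eq)
  qed
  ultimately show ?thesis unfolding split_matching_edges_def by blast
qed

text \<open>Injectivity of the coding starts here: the edge set gives back \<open>S\<close>, after
  which \<open>p\<close> can be read off edge by edge.\<close>

lemma Union_matching_of:
  assumes "(S, p) \<in> matching_codes n"
  shows "\<Union>(matching_of S p) = S"
proof -
  obtain k where S: "finite S" "S \<subseteq> {1..n}" "card S = 2 * k" and p: "p permutes {..<k}"
    and M: "matching_of S p = (\<lambda>i. {enumerate S i, enumerate S (k + p i)}) ` {..<k}"
    using assms by (rule matching_codesE)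
  have "\<Union>(matching_of S p) = enumerate S ` {..<k} \<union> enumerate S ` (\<lambda>i. k + p i) ` {..<k}"
    unfolding M by auto
  also have "(\<lambda>i. k + p i) ` {..<k} = (+) k ` p ` {..<k}" by (simp add: image_image)
  also have "\<dots> = {k..<2 * k}"
    unfolding permutes_image[OF p] using image_add_atLeastLessThan[of k 0 k]
    by (simp add: lessThan_atLeast0 mult_2)
  also have "enumerate S ` {..<k} \<union> enumerate S ` {k..<2 * k} = enumerate S ` {..<2 * k}"
    unfolding image_Un[symmetric] by (rule arg_cong[of _ _ "image _"]) auto
  also have "\<dots> = S" using finite_bij_enumerate[OF S(1)] S(3) by (simp add: bij_betw_def)
  finally show ?thesis .
qed

lemma inj_on_matching_of: "inj_on (\<lambda>(S, p). matching_of S p) (matching_codes n)"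
proof (rule inj_onI, clarify)
  fix S p T q
  assume Sp: "(S, p) \<in> matching_codes n" and Tq: "(T, q) \<in> matching_codes n"
    and eq: "matching_of S p = matching_of T q"
  have T: "T = S" using Union_matching_of[OF Sp] Union_matching_of[OF Tq] eq by simp
  obtain k where S: "finite S" "S \<subseteq> {1..n}" "card S = 2 * k" and p: "p permutes {..<k}"
    and M: "matching_of S p = (\<lambda>i. {enumerate S i, enumerate S (k + p i)}) ` {..<k}"
    using Sp by (rule matching_codesE)
  obtain k' where k': "card T = 2 * k'" and q: "q permutes {..<k'}"
    and M': "matching_of T q = (\<lambda>i. {enumerate T i, enumerate T (k' + q i)}) ` {..<k'}"
    using Tq by (rule matching_codesE)
  have kk: "k' = k" using k' S(3) T by simp
  note q = q[unfolded kk] and M' = M'[unfolded kk T]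
  have pk: "p i < k \<longleftrightarrow> i < k" "q i < k \<longleftrightarrow> i < k" for i
    using permutes_lessThan_iff[OF p] permutes_lessThan_iff[OF q] by auto
  note iff = enumerate_eq_iff[OF S(1), unfolded S(3)]
  have "p i = q i" for i
  proof (cases "i < k")
    case True
    then have "{enumerate S i, enumerate S (k + p i)} \<in> matching_of S q" using M eq T by auto
    then obtain j where j: "j < k"
      "{enumerate S i, enumerate S (k + p i)} = {enumerate S j, enumerate S (k + q j)}"
      using M' by auto
    have "i < 2 * k" "j < 2 * k" "k + p i < 2 * k" "k + q j < 2 * k"
      using True j(1) pk(1)[of i] pk(2)[of j] by auto
    then have "i = j \<and> p i = q j"
      using j True by (auto simp: doubleton_eq_iff iff)
    then show ?thesis by blast
  next
    case False
    then show ?thesis using permutes_not_in[OF p, of i] permutes_not_in[OF q, of i] by simp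
  qed
  then show "S = T \<and> p = q" using T by auto
qed

text \<open>Every left endpoint precedes every right endpoint, so the set \<open>A\<close> of left
  endpoints is an initial segment of \<open>S\<close>. Being half of \<open>S\<close>, it consists
  of the first \<open>k\<close> elements, and \<open>p\<close> records the partners.\<close>

lemma split_matching_edges_coded:
  assumes E: "E \<in> split_matching_edges n"
  shows "\<exists>S p. (S, p) \<in> matching_codes n \<and> matching_of S p = E"
proof -
  define R where "R = {(a, b). a < b \<and> {a, b} \<in> E}"
  have Ep: "E \<subseteq> vertex_pairs n" using E by (rule split_matching_edges_vertex_pairs)
  have split: "a < d" "a = c \<longleftrightarrow> b = d" if "(a, b) \<in> R" "(c, d) \<in> R" for a b c d
    using E that unfolding split_matching_edges_def R_def by blast+
  have R_range: "a \<in> {1..n} \<and> b \<in> {1..n} \<and> a < b" if "(a, b) \<in> R" for a b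
    using that Ep doubleton_in_vertex_pairs unfolding R_def by blast
  have "R \<subseteq> {1..n} \<times> {1..n}" using R_range by auto
  then have fin: "finite R" by (rule finite_subset) simp
  define A where "A = fst ` R"
  define B where "B = snd ` R"
  define S where "S = A \<union> B"
  define k where "k = card R"
  have finA: "finite A" and finB: "finite B" using fin by (auto simp: A_def B_def)
  have "inj_on fst R" "inj_on snd R" using split(2) by (auto intro!: inj_onI)
  then have cA: "card A = k" and cB: "card B = k" by (simp_all add: A_def B_def k_def card_image)
  have AB: "a < b" if "a \<in> A" "b \<in> B" for a b using that split(1) by (auto simp: A_def B_def)
  then have "A \<inter> B = {}" by blast
  then have cS: "card S = 2 * k" using finA finB cA cB by (simp add: S_def card_Un_disjoint)
  have finS: "finite S" using finA finB by (simp add: S_def)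
  note less_iff = enumerate_less_iff[OF finS, unfolded cS] and eq_iff = enumerate_eq_iff[OF finS, unfolded cS]
  have in_S: "enumerate S i \<in> S" if "i < 2 * k" for i
    using finite_enumerate_in_set[OF finS] that cS by simp
  have ex: "\<exists>i<2 * k. x = enumerate S i" if "x \<in> S" for x
    using finite_enumerate_Ex[OF finS that] cS by metis
  have "A \<subseteq> enumerate S ` {..<k}"
  proof
    fix x assume x: "x \<in> A"
    then obtain i where i: "i < 2 * k" "x = enumerate S i" using ex by (auto simp: S_def)
    have "enumerate S j \<in> A" if "j \<le> i" for j
    proof (rule ccontr)
      assume "enumerate S j \<notin> A"
      then have "enumerate S j \<in> B" using in_S[of j] that i by (auto simp: S_def)
      then have "enumerate S i < enumerate S j" using AB x i by blast
      then show False using less_iff[of i j] that i by simp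
    qed
    then have "enumerate S ` {..i} \<subseteq> A" by auto
    moreover have "inj_on (enumerate S) {..i}" using eq_iff i by (auto intro!: inj_onI)
    ultimately have "Suc i \<le> k" using card_mono[OF finA] cA by (metis card_atMost card_image)
    then show "x \<in> enumerate S ` {..<k}" using i by auto
  qed
  moreover have "card (enumerate S ` {..<k}) \<le> card A"
    using card_image_le[of "{..<k}" "enumerate S"] cA by simp
  ultimately have hA: "A = enumerate S ` {..<k}" by (intro card_seteq) auto
  have "\<exists>j<k. (enumerate S i, enumerate S (k + j)) \<in> R" if i: "i < k" for i
  proof -
    have "enumerate S i \<in> A" using i hA by auto
    then obtain b where b: "(enumerate S i, b) \<in> R" by (auto simp: A_def)
    then have bB: "b \<in> B" by (force simp: B_def)
    then obtain l where l: "l < 2 * k" "b = enumerate S l" using ex by (auto simp: S_def)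
    have "\<not> l < k" using hA bB l \<open>A \<inter> B = {}\<close> by auto
    then show ?thesis using l b by (intro exI[of _ "l - k"]) auto
  qed
  then obtain p0 where p0: "\<And>i. i < k \<Longrightarrow> p0 i < k \<and> (enumerate S i, enumerate S (k + p0 i)) \<in> R"
    by metis
  define p where "p i = (if i < k then p0 i else i)" for i
  have pR: "p i < k" "(enumerate S i, enumerate S (k + p i)) \<in> R" if "i < k" for i
    using p0 that by (auto simp: p_def)
  have p: "p permutes {..<k}"
  proof (rule bij_imp_permutes)
    have inj: "inj_on p {..<k}"
    proof (rule inj_onI)
      fix i j assume "i \<in> {..<k}" "j \<in> {..<k}" "p i = p j"
      then have ij: "i < k" "j < k" "p i = p j" by auto
      have "enumerate S i = enumerate S j"
        using split(2)[OF pR(2)[OF ij(1)] pR(2)[OF ij(2)]] ij(3) by simp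
      then show "i = j" using eq_iff ij by simp
    qed
    moreover have "p ` {..<k} \<subseteq> {..<k}" using pR by auto
    ultimately show "bij_betw p {..<k} {..<k}"
      using endo_inj_surj[of "{..<k}" p] by (simp add: bij_betw_def)
  qed (simp add: p_def)
  have "S \<subseteq> {1..n}" using R_range by (force simp: S_def A_def B_def)
  then have code: "(S, p) \<in> matching_codes n" using p cS by (simp add: matching_codes_def)
  have M: "matching_of S p = (\<lambda>i. {enumerate S i, enumerate S (k + p i)}) ` {..<k}"
    using cS by (simp add: matching_of_def)
  have "matching_of S p = E"
  proof
    show "matching_of S p \<subseteq> E" using pR(2) unfolding M by (auto simp: R_def)
    show "E \<subseteq> matching_of S p"
    proof
      fix e assume e: "e \<in> E"
      then obtain a b where ab: "e = {a, b}" "a < b" using Ep by (meson subsetD vertex_pairsE)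
      then have R: "(a, b) \<in> R" using e by (simp add: R_def)
      then have "a \<in> A" by (force simp: A_def)
      then obtain i where i: "i < k" "a = enumerate S i" using hA by auto
      then have "b = enumerate S (k + p i)" using split(2)[OF R pR(2)[OF i(1)]] by simp
      then show "e \<in> matching_of S p" unfolding M using i ab by auto
    qed
  qed
  with code show ?thesis by blast
qed

theorem card_split_matching_edges: "card (split_matching_edges n) = min_speed n"
proof -
  have "bij_betw (\<lambda>(S, p). matching_of S p) (matching_codes n) (split_matching_edges n)"
    unfolding bij_betw_def
  proof
    show "(\<lambda>(S, p). matching_of S p) ` matching_codes n = split_matching_edges n"
    proof
      show "(\<lambda>(S, p). matching_of S p) ` matching_codes n \<subseteq> split_matching_edges n"
        using matching_of_in_split_matching_edges by auto
      show "split_matching_edges n \<subseteq> (\<lambda>(S, p). matching_of S p) ` matching_codes n"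
      proof
        fix E assume "E \<in> split_matching_edges n"
        then obtain S p where "(S, p) \<in> matching_codes n" "matching_of S p = E"
          using split_matching_edges_coded by blast
        then show "E \<in> (\<lambda>(S, p). matching_of S p) ` matching_codes n"
          by (intro image_eqI[of _ _ "(S, p)"]) auto
      qed
    qed
  qed (rule inj_on_matching_of)
  then show ?thesis using card_matching_codes by (metis bij_betw_same_card)
qed

section \<open>Growth of the minimal speed\<close>

lemma min_speed_ge_fact: "fact (n div 2) \<le> min_speed n"
proof -
  have "1 * fact (n div 2) \<le> (n choose (2 * (n div 2))) * (fact (n div 2) :: nat)"
    by (intro mult_right_mono) (simp_all add: Suc_le_eq)
  also have "\<dots> \<le> min_speed n"
    unfolding min_speed_def by (rule member_le_sum) auto
  finally show ?thesis by simp
qed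

text \<open>Each factorial is at most \<open>n ^ (n div 2)\<close> for positive \<open>n\<close>,
  and the binomials add up to at most \<open>2 ^ n\<close>. Together with the lower bound by the
  last summand this fixes the leading term of the logarithm.\<close>

lemma min_speed_le: "min_speed n \<le> 2 ^ n * n ^ (n div 2)"
proof (cases "n = 0")
  case True
  then show ?thesis by (simp add: min_speed_def)
next
  case False
  have "min_speed n \<le> (\<Sum>k=0..n div 2. (n choose (2 * k)) * n ^ (n div 2))"
    unfolding min_speed_def
  proof (intro sum_mono mult_left_mono)
    fix k assume k: "k \<in> {0..n div 2}"
    have "fact k \<le> k ^ k" using fact_le_power[of k, where 'a = nat] by simp
    also have "\<dots> \<le> n ^ k" using k by (intro power_mono) auto
    also have "\<dots> \<le> n ^ (n div 2)" using k False by (intro power_increasing) auto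
    finally show "fact k \<le> n ^ (n div 2)" .
  qed simp
  also have "\<dots> = (\<Sum>j\<in>(*) 2 ` {0..n div 2}. n choose j) * n ^ (n div 2)"
    by (simp add: sum_distrib_right sum.reindex inj_on_def)
  also have "(\<Sum>j\<in>(*) 2 ` {0..n div 2}. n choose j) \<le> (\<Sum>j\<le>n. n choose j)"
    by (intro sum_mono2) auto
  also have "\<dots> = 2 ^ n" by (rule choose_row_sum)
  finally show ?thesis by simp
qed

text \<open>The single term \<open>m ^ m / fact m\<close> of the series for \<open>exp m\<close> is
  at most its sum. This much of Stirling's formula is enough.\<close>

lemma ln_fact_ge:
  assumes "m > 0"
  shows "real m * ln (real m) - real m \<le> ln (fact m)"
proof -
  have "(\<Sum>i\<in>{m}. inverse (fact i) * real m ^ i) \<le> (\<Sum>i. inverse (fact i) * real m ^ i)"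
    by (intro sum_le_suminf summable_exp) auto
  then have "real m ^ m / fact m \<le> exp (real m)"
    by (simp add: exp_def divide_inverse mult.commute)
  then have "ln (real m ^ m / fact m) \<le> ln (exp (real m))"
    using assms by (intro ln_mono) auto
  then show ?thesis using assms by (simp add: ln_div ln_realpow)
qed

text \<open>The error \<open>\<epsilon>\<close> is obtained by solving for the exponent, so that
  only its size needs an estimate: it is at most of order \<open>n / ln n\<close>. The value
  \<open>n = 0\<close> is excluded, as \<open>min_speed 0 = 1\<close> while
  \<open>0 powr x = 0\<close>.\<close>

theorem min_speed_asymptotics:
  "\<exists>\<epsilon> :: nat \<Rightarrow> real. \<epsilon> \<in> o(\<lambda>n. real n) \<and>
     (\<forall>n\<ge>1. real (min_speed n) = real n powr (real n / 2 + \<epsilon> n))"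
proof -
  define \<epsilon> where "\<epsilon> n = ln (min_speed n) / ln n - n / 2" for n :: nat
  have pos: "min_speed n > 0" for n
    using min_speed_ge_fact[of n] fact_gt_zero[of "n div 2", where 'a = nat] by linarith
  have bound: "\<bar>\<epsilon> n\<bar> \<le> 3 * n / ln n + 1" if n: "n \<ge> 4" for n :: nat
  proof -
    let ?m = "n div 2"
    have ln_n: "ln n > 0" using n by simp
    have ln2: "ln 2 \<le> (1 :: real)" using ln_le_minus_one[of "2 :: real"] by simp
    have "real (min_speed n) \<le> real (2 ^ n * n ^ ?m)"
      using min_speed_le[of n] by (rule of_nat_mono)
    then have "ln (min_speed n) \<le> ln (2 ^ n * real n ^ ?m)"
      using pos[of n] n by (intro ln_mono) auto
    also have "\<dots> = n * ln 2 + real ?m * ln n"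
      using n by (simp add: ln_mult ln_realpow)
    also have "\<dots> \<le> n * 1 + n / 2 * ln n"
      using n ln2 ln_n by (intro add_mono mult_mono) auto
    finally have upper: "ln (min_speed n) - n / 2 * ln n \<le> n" by simp
    have m: "real n / 2 - 1 / 2 \<le> real ?m" "real ?m \<le> real n" "?m > 0" "real n \<le> 4 * real ?m"
      using n by linarith+
    have "ln n - 2 * ln 2 = ln (n / 4)"
      using n ln_realpow[of 2 2] by (simp add: ln_div)
    also have "\<dots> \<le> ln ?m" using m(3,4) n by (intro ln_mono) auto
    finally have "ln n - 2 \<le> ln ?m" using ln2 by simp
    then have "real ?m * (ln n - 2) \<le> real ?m * ln ?m" by (rule mult_left_mono) simp
    \<comment> \<open>The loss of \<open>3 * ?m\<close> consists of \<open>?m\<close> from the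
      factorial estimate and \<open>2 * ?m\<close> from replacing \<open>ln ?m\<close> by
      \<open>ln n - 2\<close>.\<close>
    then have "real ?m * ln n - 3 * real ?m \<le> real ?m * ln ?m - ?m" by (simp add: algebra_simps)
    also have "\<dots> \<le> ln (fact ?m)" using m(3) by (rule ln_fact_ge)
    also have "real (fact ?m) \<le> real (min_speed n)" using min_speed_ge_fact by (rule of_nat_mono)
    then have "ln (fact ?m) \<le> ln (min_speed n)" by (intro ln_mono) simp_all
    finally have "real ?m * ln n - 3 * real ?m \<le> ln (min_speed n)" .
    moreover have "(n / 2 - 1 / 2) * ln n \<le> ?m * ln n" using m(1) ln_n by (intro mult_right_mono) auto
    ultimately have lower: "- (3 * n + ln n) \<le> ln (min_speed n) - n / 2 * ln n"
      using m(2) ln_n by (simp add: algebra_simps)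
    have "\<epsilon> n * ln n = ln (min_speed n) - n / 2 * ln n"
      using ln_n by (simp add: \<epsilon>_def field_simps)
    then have "\<bar>\<epsilon> n\<bar> * ln n \<le> 3 * n + ln n"
      using upper lower ln_n by (simp add: abs_if algebra_simps split: if_splits)
    then show ?thesis using ln_n by (simp add: field_simps)
  qed
  have "\<epsilon> \<in> O(\<lambda>n. 3 * real n / ln (real n) + 1)"
  proof (rule bigoI[of _ 1], rule eventually_mono[OF eventually_ge_at_top[of 4]])
    fix n :: nat assume n: "4 \<le> n"
    then show "norm (\<epsilon> n) \<le> 1 * norm (3 * real n / ln (real n) + 1)"
      using bound[OF n] by simp
  qed
  also have "(\<lambda>n. 3 * real n / ln (real n) + 1) \<in> o(\<lambda>n. real n)" by real_asymp
  finally have "\<epsilon> \<in> o(\<lambda>n. real n)" .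
  moreover have "real (min_speed n) = real n powr (real n / 2 + \<epsilon> n)" if "n \<ge> 1" for n
  proof (cases "n = 1")
    \<comment> \<open>Here \<open>ln n = 0\<close>, so \<open>\<epsilon>\<close> involves a division
      by zero, but a power with base 1 is 1 for every exponent.\<close>
    case True
    then show ?thesis by (simp add: min_speed_def)
  next
    case False
    then have "ln n > 0" "n > 0" using that by simp_all
    then show ?thesis using pos[of n] by (simp add: \<epsilon>_def powr_def)
  qed
  ultimately show ?thesis by blast
qed

section \<open>From superexponential speed to the lower bound and uniqueness\<close>

text \<open>With \<open>N = 2 * m\<close> the speed is at least \<open>fact m\<close>, which exceeds
  \<open>(c\<^sup>2) ^ m = c ^ N\<close> once \<open>m\<close> is large. This makes the lower bound
  results applicable to a property known only by its speed.\<close>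

lemma superexponential_if_min_speed_le:
  assumes "\<And>n. min_speed n \<le> speed P n"
  shows "superexponential P"
  unfolding superexponential_def
proof (intro allI impI)
  fix c :: real assume "c > 0"
  have "(\<lambda>m. inverse (fact m) * (c\<^sup>2) ^ m) \<longlonglongrightarrow> 0"
    by (rule summable_LIMSEQ_zero[OF summable_exp])
  then have "\<forall>\<^sub>F m in sequentially. inverse (fact m) * (c\<^sup>2) ^ m < 1"
    by (rule order_tendstoD) simp
  then obtain m where "inverse (fact m) * (c\<^sup>2) ^ m < 1"
    by (auto simp: eventually_sequentially)
  then have "(c\<^sup>2) ^ m < fact m" by (simp add: field_simps)
  then have "c ^ (2 * m) < fact m" by (simp only: power_mult)
  also have "fact m \<le> real (min_speed (2 * m))"
    using of_nat_mono[OF min_speed_ge_fact[of "2 * m"], where 'a = real] by simp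
  also have "\<dots> \<le> real (speed P (2 * m))" using assms by simp
  finally show "\<exists>N. c ^ N < real (speed P N)" by blast
qed

lemma perm_ograph_in_if_superexponential:
  assumes P: "hereditary P" "omits_complete P" and super: "superexponential P"
    and p: "p permutes {1..k}"
  shows "perm_ograph k p \<in> P"
proof (rule ccontr)
  assume "perm_ograph k p \<notin> P"
  then obtain D where D: "\<And>n. card (std_edges P n) \<le> 2 ^ (D * Suc n)"
    using card_std_edges_le[OF P p] by blast
  have property: "ograph_property P" using P(1) by (simp add: hereditary_def)
  \<comment> \<open>The \<open>N\<close>-th power of \<open>2 ^ (2 * D)\<close> is at least
    \<open>2 ^ (D * Suc N)\<close> for \<open>N \<ge> 1\<close>; on 0 vertices there is at most the
    empty graph.\<close>
  obtain N where "real (speed P N) > (2 ^ (2 * D)) ^ N"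
    using super unfolding superexponential_def by (meson zero_less_numeral zero_less_power)
  then have "real (card (std_edges P N)) > real (2 ^ (2 * D * N))"
    unfolding speed_eq_card_std_edges[OF property] by (simp add: power_mult)
  then have N: "card (std_edges P N) > 2 ^ (2 * D * N)" unfolding of_nat_less_iff .
  show False
  proof (cases "N = 0")
    case True
    have "std_edges P N \<subseteq> {{}}" by (auto simp: True std_edges_def vertex_pairs_def)
    then have "card (std_edges P N) \<le> card {{} :: nat set set}" by (intro card_mono) auto
    with N True show False by simp
  next
    case False
    then have "D * Suc N \<le> 2 * D * N" by (cases N) (simp_all add: algebra_simps)
    then have "2 ^ (D * Suc N) \<le> (2 :: nat) ^ (2 * D * N)" by (intro power_increasing) auto
    with D[of N] N show False by linarith
  qed
qed

lemma split_matching_edges_subset_if_superexponential: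
  assumes "hereditary P" "omits_complete P" "superexponential P"
  shows "split_matching_edges n \<subseteq> std_edges P n"
  using split_matching_in_if_perm_graphs[OF assms(1) perm_ograph_in_if_superexponential[OF assms]]
    split_matching_edges_vertex_pairs unfolding std_edges_def by blast

lemma speed_split_matching: "speed {G. split_matching G} n = min_speed n"
  using speed_eq_card_std_edges[of "{G. split_matching G}" n] hereditary_split_matching
  by (simp add: hereditary_def std_edges_split_matching card_split_matching_edges)

text \<open>The minimal speed is superexponential, so \<open>Q\<close> contains all split matchings.
  On each level these are already as many as the graphs of \<open>Q\<close>, and a property is
  determined by its standard members.\<close>

lemma eq_split_matching_if_min_speed:
  assumes Q: "hereditary Q" "omits_complete Q" and speed: "\<And>n. speed Q n = min_speed n"
  shows "Q = {G. split_matching G}"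
proof -
  have property: "ograph_property Q" using Q(1) by (simp add: hereditary_def)
  have "superexponential Q" by (rule superexponential_if_min_speed_le) (simp add: speed)
  from split_matching_edges_subset_if_superexponential[OF Q this]
  have edges: "split_matching_edges n = std_edges Q n" for n
    using speed[of n] by (intro card_subset_eq)
      (simp_all add: finite_std_edges card_split_matching_edges speed_eq_card_std_edges[OF property])
  have M: "ograph_property {G. split_matching G}"
    using hereditary_split_matching by (simp add: hereditary_def)
  have "G \<in> P'" if "G \<in> P" and P: "ograph_property P" and P': "ograph_property P'"
    and eq: "\<And>n. std_edges P n = std_edges P' n" for G :: "nat ograph" and P P'
  proof -
    obtain E where E: "E \<in> std_edges P (card (verts G))" "ograph_iso (std_ograph (card (verts G)) E) G"
      using ex_std_edges_iso[OF P \<open>G \<in> P\<close>] .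
    then have "std_ograph (card (verts G)) E \<in> P'" unfolding eq by (simp add: std_edges_def)
    then show ?thesis
      using E(2) ograph_property_iso[OF P'] ograph_property_ordered[OF P \<open>G \<in> P\<close>] by blast
  qed
  from this[OF _ property M] this[OF _ M property] show ?thesis
    using edges std_edges_split_matching by blast
qed

text \<open>All split matchings lie in \<open>P\<close>, and having maximum degree at most 1 they
  already lie in the smaller collection.\<close>

lemma min_speed_le_speed_max_degree_le_1:
  assumes P: "hereditary P" "omits_complete P" "superexponential P"
  shows "min_speed n \<le> speed (max_degree_le_1 P) n" "speed (max_degree_le_1 P) n \<le> speed P n"
proof -
  have property: "ograph_property P" using P(1) by (simp add: hereditary_def)
  note speed = speed_eq_card_std_edges[OF property]
    speed_eq_card_std_edges[OF ograph_property_max_degree_le_1[OF property]]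
  have "split_matching_edges n \<subseteq> std_edges (max_degree_le_1 P) n"
    using split_matching_edges_subset_if_superexponential[OF P, of n] split_matching_edges_max_degree[of _ n P]
    unfolding std_edges_def by blast
  then show "min_speed n \<le> speed (max_degree_le_1 P) n"
    unfolding speed card_split_matching_edges[symmetric] by (intro card_mono finite_std_edges)
  have "std_edges (max_degree_le_1 P) n \<subseteq> std_edges P n"
    unfolding std_edges_def max_degree_le_1_def by blast
  then show "speed (max_degree_le_1 P) n \<le> speed P n"
    unfolding speed by (intro card_mono finite_std_edges)
qed

theorem theorem5:
  "(\<forall>P. hereditary P \<and> omits_complete P \<and> superexponential P \<longrightarrow>
       (\<forall>k p. p permutes {1..k} \<longrightarrow> perm_ograph k p \<in> P) \<and>
       (\<forall>n. speed P n \<ge> speed (max_degree_le_1 P) n \<and>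
            speed (max_degree_le_1 P) n \<ge> min_speed n)) \<and>
   (\<exists>\<epsilon> :: nat \<Rightarrow> real. \<epsilon> \<in> o(\<lambda>n. real n) \<and>
       (\<forall>n\<ge>1. real (min_speed n) = real n powr (real n / 2 + \<epsilon> n))) \<and>
   (\<exists>P. hereditary P \<and> omits_complete P \<and> superexponential P \<and>
       (\<forall>n. speed P n = min_speed n)) \<and>
   (\<exists>!Q. hereditary Q \<and> omits_complete Q \<and> (\<forall>n. speed Q n = min_speed n))"
proof (intro conjI)
  show "\<forall>P. hereditary P \<and> omits_complete P \<and> superexponential P \<longrightarrow>
       (\<forall>k p. p permutes {1..k} \<longrightarrow> perm_ograph k p \<in> P) \<and>
       (\<forall>n. speed P n \<ge> speed (max_degree_le_1 P) n \<and>
            speed (max_degree_le_1 P) n \<ge> min_speed n)"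
    using perm_ograph_in_if_superexponential min_speed_le_speed_max_degree_le_1 by blast
  show "\<exists>\<epsilon> :: nat \<Rightarrow> real. \<epsilon> \<in> o(\<lambda>n. real n) \<and>
       (\<forall>n\<ge>1. real (min_speed n) = real n powr (real n / 2 + \<epsilon> n))"
    by (rule min_speed_asymptotics)
  \<comment> \<open>The split matchings show that the bound is attained under all hypotheses, and
    they also supply the existence half of uniqueness.\<close>
  have "superexponential {G. split_matching G}"
    by (rule superexponential_if_min_speed_le) (simp add: speed_split_matching)
  then show "\<exists>P. hereditary P \<and> omits_complete P \<and> superexponential P \<and>
       (\<forall>n. speed P n = min_speed n)"
    using hereditary_split_matching omits_complete_split_matching speed_split_matching by blast
  show "\<exists>!Q. hereditary Q \<and> omits_complete Q \<and> (\<forall>n. speed Q n = min_speed n)"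
    using hereditary_split_matching omits_complete_split_matching speed_split_matching
      eq_split_matching_if_min_speed by (intro ex1I[of _ "{G. split_matching G}"]) blast+
qed

end
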